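(* Let $ok\in AP$. The following problem is undecidable: given an ACGS $M=(G,\pi)$ whose set of agents $Ag$ satisfies $\{1,2,3\}\subseteq Ag$, with $\pi(1)=\pi(2)=\mathtt{iR}$ and $\pi(i)=\mathtt{IR}$ for all $i\in Ag\setminus\{1,2\}$, decide whether $M,s\models\langle\langle\{1,2\}\rangle\rangle\mathbf G\, ok$ for every initial state $s$ of $M$ (here $\langle\langle\{1,2\}\rangle\rangle\mathbf G\,ok$ is regarded as an ATL or ATL$^\ast$ formula).
   Context: Fix a finite set $AP$ of atomic propositions. A concurrent game structure (CGS) is a tuple $G=(S,S_0,Ag,(Ac_i)_{i\in Ag},(\sim_i)_{i\in Ag},(P_i)_{i\in Ag},\Delta,\lambda)$ where $S$ is a finite set of states, $S_0\subseteq S$ initial states, $Ag=\{1,\dots,n\}$ agents, $Ac_i$ finite local actions of agent $i$, $\sim_i\subseteq S\times S$ an equivalence relation, $P_i:S\to 2^{Ac_i}$ a protocol with $P_i(s)=P_i(s')$ whenever $s\sim_i s'$, $\Delta:S\times\prod_{i\in Ag}Ac_i\to S$, and $\lambda:S\to 2^{AP}$. A path is an infinite sequence $s_0s_1\dots$ with $s_{j+1}=\Delta(s_j,\vec a_j)$ for some $\vec a_j\in\prod_iP_i(s_j)$; a history is a finite nonempty prefix of a path ($\mathrm{FPath}$ the set of histories, $\mathrm{last}(\rho)$ its last state). Histories $s_0\dots s_m$, $s'_0\dots s'_m$ are indistinguishable for $i$ if $s_j\sim_i s'_j$ for all $j$. Strategy types: an $\mathtt{Ir}$-strategy of $i$ is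 $\theta:S\to Ac_i$ with $\theta(s)\in P_i(s)$; an $\mathtt{IR}$-strategy is $\theta:\mathrm{FPath}\to Ac_i$ with $\theta(\rho)\in P_i(\mathrm{last}(\rho))$; $\mathtt{ir}$-strategies are $\mathtt{Ir}$-strategies with $s\sim_is'\Rightarrow\theta(s)=\theta(s')$; $\mathtt{iR}$-strategies are $\mathtt{IR}$-strategies giving equal actions on histories indistinguishable for $i$. Memoryless strategies act on histories via the last state. Given a state $s$ and a strategy for every agent, the play from $s$ is the unique path $\rho$ with $\rho_0=s$, $\rho_{j+1}=\Delta(\rho_j,\vec a_j)$, $\vec a_j(i)$ being the action of $i$'s strategy on $\rho_0\dots\rho_j$. An ACGS is a pair $M=(G,\pi)$ with $\pi:Ag\to\{\mathtt{Ir},\mathtt{IR},\mathtt{ir},\mathtt{iR}\}$ such that $\sim_i$ is the identity whenever $\pi(i)\in\{\mathtt{IR},\mathtt{Ir}\}$. For $A\subseteq Ag$, $M,s\models\langle\langle A\rangle\rangle\phi$ iff there is an assignment of a $\pi(i)$-strategy to each $i\in A$ such that for every assignment of a $\pi(i)$-strategy to each $i\in Ag\setminus A$, the resulting play from $s$ satisfies the path formula $\phi$. In particular $M,s\models\langle\langle A\rangle\rangle\mathbf G\,ok$ means the play visits only states $t$ with $ok\in\lambda(t)$. *)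

theory Defs
  imports Main "HOL-Library.Nat_Bijection"
begin

datatype stype = Ir | IR | ir | iR

text \<open>Agents are natural numbers; an action profile is a function from agents to actions
(only the values on the agent set matter, enforced by well-formedness).\<close>

record ('s,'a,'p) cgs =
  St :: "'s set"
  Init :: "'s set"
  Ag :: "nat set"
  Ac :: "nat \<Rightarrow> 'a set"
  Ind :: "nat \<Rightarrow> ('s \<times> 's) set"
  Prot :: "nat \<Rightarrow> 's \<Rightarrow> 'a set"
  Delta :: "'s \<Rightarrow> (nat \<Rightarrow> 'a) \<Rightarrow> 's"
  Lab :: "'s \<Rightarrow> 'p set"

definition cgs_wf :: "'p set \<Rightarrow> ('s,'a,'p) cgs \<Rightarrow> bool" where
  "cgs_wf AP G \<longleftrightarrow>
     finite (St G) \<and> Init G \<subseteq> St G \<and> (\<exists>n. Ag G = {1..n}) \<and>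
     (\<forall>i\<in>Ag G. finite (Ac G i) \<and> equiv (St G) (Ind G i) \<and>
        (\<forall>s\<in>St G. Prot G i s \<subseteq> Ac G i) \<and>
        (\<forall>s s'. (s, s') \<in> Ind G i \<longrightarrow> Prot G i s = Prot G i s')) \<and>
     (\<forall>s\<in>St G. \<forall>a. (\<forall>i\<in>Ag G. a i \<in> Ac G i) \<longrightarrow> Delta G s a \<in> St G) \<and>
     (\<forall>s\<in>St G. \<forall>a b. (\<forall>i\<in>Ag G. a i = b i) \<longrightarrow> Delta G s a = Delta G s b) \<and>
     (\<forall>s\<in>St G. Lab G s \<subseteq> AP)"

definition acgs_wf :: "'p set \<Rightarrow> ('s,'a,'p) cgs \<Rightarrow> (nat \<Rightarrow> stype) \<Rightarrow> bool" where
  "acgs_wf AP G \<pi> \<longleftrightarrow> cgs_wf AP G \<and>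
     (\<forall>i\<in>Ag G. \<pi> i \<in> {IR, Ir} \<longrightarrow> Ind G i = Id_on (St G))"

definition is_path :: "('s,'a,'p) cgs \<Rightarrow> (nat \<Rightarrow> 's) \<Rightarrow> bool" where
  "is_path G r \<longleftrightarrow> r 0 \<in> St G \<and>
     (\<forall>j. \<exists>a. (\<forall>i\<in>Ag G. a i \<in> Prot G i (r j)) \<and> r (Suc j) = Delta G (r j) a)"

definition FPath :: "('s,'a,'p) cgs \<Rightarrow> 's list set" where
  "FPath G = {map r [0..<Suc n] | r n. is_path G r}"

definition indist :: "('s,'a,'p) cgs \<Rightarrow> nat \<Rightarrow> 's list \<Rightarrow> 's list \<Rightarrow> bool" where
  "indist G i \<rho> \<rho>' \<longleftrightarrow> length \<rho> = length \<rho>' \<and> (\<forall>j<length \<rho>. (\<rho> ! j, \<rho>' ! j) \<in> Ind G i)"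

definition Ir_strat :: "('s,'a,'p) cgs \<Rightarrow> nat \<Rightarrow> ('s \<Rightarrow> 'a) \<Rightarrow> bool" where
  "Ir_strat G i \<theta> \<longleftrightarrow> (\<forall>s\<in>St G. \<theta> s \<in> Prot G i s)"

definition ir_strat :: "('s,'a,'p) cgs \<Rightarrow> nat \<Rightarrow> ('s \<Rightarrow> 'a) \<Rightarrow> bool" where
  "ir_strat G i \<theta> \<longleftrightarrow> Ir_strat G i \<theta> \<and> (\<forall>s s'. (s, s') \<in> Ind G i \<longrightarrow> \<theta> s = \<theta> s')"

definition IR_strat :: "('s,'a,'p) cgs \<Rightarrow> nat \<Rightarrow> ('s list \<Rightarrow> 'a) \<Rightarrow> bool" where
  "IR_strat G i \<theta> \<longleftrightarrow> (\<forall>\<rho>\<in>FPath G. \<theta> \<rho> \<in> Prot G i (last \<rho>))"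

definition iR_strat :: "('s,'a,'p) cgs \<Rightarrow> nat \<Rightarrow> ('s list \<Rightarrow> 'a) \<Rightarrow> bool" where
  "iR_strat G i \<theta> \<longleftrightarrow> IR_strat G i \<theta> \<and>
     (\<forall>\<rho>\<in>FPath G. \<forall>\<rho>'\<in>FPath G. indist G i \<rho> \<rho>' \<longrightarrow> \<theta> \<rho> = \<theta> \<rho>')"

definition strats :: "('s,'a,'p) cgs \<Rightarrow> (nat \<Rightarrow> stype) \<Rightarrow> nat \<Rightarrow> ('s list \<Rightarrow> 'a) set" where
  "strats G \<pi> i = (case \<pi> i of
       Ir \<Rightarrow> {(\<lambda>\<rho>. \<theta> (last \<rho>)) | \<theta>. Ir_strat G i \<theta>}
     | ir \<Rightarrow> {(\<lambda>\<rho>. \<theta> (last \<rho>)) | \<theta>. ir_strat G i \<theta>}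
     | IR \<Rightarrow> {\<theta>. IR_strat G i \<theta>}
     | iR \<Rightarrow> {\<theta>. iR_strat G i \<theta>})"

fun hist :: "('s,'a,'p) cgs \<Rightarrow> (nat \<Rightarrow> 's list \<Rightarrow> 'a) \<Rightarrow> 's \<Rightarrow> nat \<Rightarrow> 's list" where
  "hist G \<sigma> s 0 = [s]"
| "hist G \<sigma> s (Suc j) = (let h = hist G \<sigma> s j in h @ [Delta G (last h) (\<lambda>i. \<sigma> i h)])"

definition play :: "('s,'a,'p) cgs \<Rightarrow> (nat \<Rightarrow> 's list \<Rightarrow> 'a) \<Rightarrow> 's \<Rightarrow> nat \<Rightarrow> 's" where
  "play G \<sigma> s j = last (hist G \<sigma> s j)"

definition sat_AG :: "('s,'a,'p) cgs \<Rightarrow> (nat \<Rightarrow> stype) \<Rightarrow> nat set \<Rightarrow> 'p \<Rightarrow> 's \<Rightarrow> bool" where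
  "sat_AG G \<pi> A ok s \<longleftrightarrow>
     (\<exists>\<sigma>A. (\<forall>i\<in>A. \<sigma>A i \<in> strats G \<pi> i) \<and>
        (\<forall>\<sigma>B. (\<forall>i\<in>Ag G - A. \<sigma>B i \<in> strats G \<pi> i) \<longrightarrow>
           (\<forall>j. ok \<in> Lab G (play G (\<lambda>i. if i \<in> A then \<sigma>A i else \<sigma>B i) s j))))"

record desc =
  d_n :: nat
  d_init :: "nat list"
  d_m :: nat
  d_k :: "nat list"
  d_obs :: "(nat \<times> nat \<times> nat) list"
  d_prot :: "(nat \<times> nat \<times> nat) list"
  d_trans :: "(nat \<times> nat list \<times> nat) list"
  d_lab :: "(nat \<times> nat) list"
  d_typ :: "nat list"

definition decode :: "desc \<Rightarrow> (nat, nat, nat) cgs" where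
  "decode d = \<lparr> St = {0..<d_n d}, Init = set (d_init d), Ag = {1..d_m d},
     Ac = (\<lambda>i. {0..<d_k d ! (i - 1)}),
     Ind = (\<lambda>i. {(s, t). (i, s, t) \<in> set (d_obs d)}),
     Prot = (\<lambda>i s. {a. (i, s, a) \<in> set (d_prot d)}),
     Delta = (\<lambda>s a. case find (\<lambda>(s', as, t). s' = s \<and> as = map a [1..<Suc (d_m d)]) (d_trans d) of
                      Some (_, _, t) \<Rightarrow> t | None \<Rightarrow> 0),
     Lab = (\<lambda>s. {p. (s, p) \<in> set (d_lab d)}) \<rparr>"

definition decode_typ :: "desc \<Rightarrow> nat \<Rightarrow> stype" where
  "decode_typ d i = (case d_typ d ! (i - 1) of 0 \<Rightarrow> Ir | Suc 0 \<Rightarrow> IR | Suc (Suc 0) \<Rightarrow> ir | _ \<Rightarrow> iR)"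

definition enc3 :: "nat \<times> nat \<times> nat \<Rightarrow> nat" where
  "enc3 x = (case x of (a, b, c) \<Rightarrow> prod_encode (a, prod_encode (b, c)))"

definition code :: "desc \<Rightarrow> nat" where
  "code d = list_encode [d_n d, list_encode (d_init d), d_m d, list_encode (d_k d),
     list_encode (map enc3 (d_obs d)), list_encode (map enc3 (d_prot d)),
     list_encode (map (\<lambda>(s, as, t). prod_encode (s, prod_encode (list_encode as, t))) (d_trans d)),
     list_encode (map prod_encode (d_lab d)), list_encode (d_typ d)]"

definition valid :: "nat set \<Rightarrow> desc \<Rightarrow> bool" where
  "valid AP d \<longleftrightarrow> length (d_k d) = d_m d \<and> length (d_typ d) = d_m d \<and>
     acgs_wf AP (decode d) (decode_typ d) \<and> {1, 2, 3} \<subseteq> Ag (decode d) \<and>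
     decode_typ d 1 = iR \<and> decode_typ d 2 = iR \<and>
     (\<forall>i\<in>Ag (decode d) - {1, 2}. decode_typ d i = IR)"

datatype recf = z | s | id nat nat | Cn nat recf "recf list" | Pr nat recf recf | Mn nat recf

inductive reval :: "recf \<Rightarrow> nat list \<Rightarrow> nat \<Rightarrow> bool" where
  reval_z: "reval z [n] 0"
| reval_s: "reval s [n] (Suc n)"
| reval_id: "\<lbrakk>i < n; length xs = n\<rbrakk> \<Longrightarrow> reval (id n i) xs (xs ! i)"
| reval_Cn: "\<lbrakk>length xs = n; length ys = length gs; \<forall>k<length gs. reval (gs ! k) xs (ys ! k);
     reval f ys r\<rbrakk> \<Longrightarrow> reval (Cn n f gs) xs r"
| reval_Pr0: "\<lbrakk>length xs = n; reval f xs r\<rbrakk> \<Longrightarrow> reval (Pr n f g) (xs @ [0]) r"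
| reval_PrS: "\<lbrakk>length xs = n; reval (Pr n f g) (xs @ [y]) r1; reval g (xs @ [y, r1]) r\<rbrakk>
     \<Longrightarrow> reval (Pr n f g) (xs @ [Suc y]) r"
| reval_Mn: "\<lbrakk>length xs = n; reval f (xs @ [r]) 0; \<forall>i<r. \<exists>v. reval f (xs @ [i]) v \<and> 0 < v\<rbrakk>
     \<Longrightarrow> reval (Mn n f) xs r"

end

theory Submission
  imports Defs
begin

text \<open>
  Nonhalting of a counter machine is the existence of a tiling of the quadrant \<open>\<nat> \<times> \<nat>\<close>, and a
  tiling is a winning strategy: agent 3 lets each of the agents 1 and 2 see \<open>W\<close> for \<open>a + 1\<close> steps, then
  \<open>W'\<close> for \<open>b + 1\<close> steps, and then asks for the tile at \<open>(a, b)\<close>. Each agent sees only its own signals,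
  and agent 3 can delay those of agent 2 by one step in either phase. An agent therefore cannot tell
  whether its answer will be tested for equality with the answer of the other agent, or for
  compatibility with its answer at a horizontal or vertical neighbour; so the agents win only by
  answering according to one and the same tiling.

  Given a decider \<open>f\<close>, let \<open>c\<close> be a machine that halts on \<open>x\<close> iff \<open>f\<close> accepts the game obtained from
  the template with code \<open>x\<close> by adding the input \<open>x\<close>. The input enters the game as a chain of \<open>x\<close>
  states, so this substitution is an easy recursive function on codes. When \<open>x\<close> is the template of the
  game of \<open>c\<close> itself, \<open>c\<close> halts on \<open>x\<close> iff it does not.
\<close>

section \<open>Counter programs for recursive functions\<close>

text \<open>The obstacle is self-reference through the concrete function \<open>code\<close>: the
  decider is fed the code of a game containing the very number from which this code is computed. No
  general recursion theorem is invoked; it is enough that \<open>instance_code\<close> is right at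
  one number, the template of the game of \<open>c\<close>. This works because the tile set and its
  constraints depend on \<open>c\<close> alone, while the number enters afterwards, as the length of
  a chain. What grows with the input must be written in front of coded lists that do not grow. A
  list code is extended at its front by one pairing and a successor, so the fixed lists can stay
  opaque numbers. This dictates the numbering of states: the added states come last, and for each
  player the only observation class that grows is an interval of numbers. On the tiling side,
  changing a unary register by one moves its end to the next column, which relates diagonal
  neighbours, whereas the game tests only horizontal and vertical ones. Therefore tiles look one
  column ahead.\<close>

datatype oper = Inc nat | Dec nat | Cpy nat nat
datatype com = Op oper | Seq com com | While nat com

fun apply_op :: "oper \<Rightarrow> (nat \<Rightarrow> nat) \<Rightarrow> nat \<Rightarrow> nat" where
  "apply_op (Inc r) v = v(r := Suc (v r))"
| "apply_op (Dec r) v = v(r := v r - 1)"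
| "apply_op (Cpy r q) v = v(r := v q)"

inductive big :: "com \<Rightarrow> (nat \<Rightarrow> nat) \<Rightarrow> (nat \<Rightarrow> nat) \<Rightarrow> bool" where
  big_Op: "big (Op p) v (apply_op p v)"
| big_Seq: "\<lbrakk>big c u v; big d v w\<rbrakk> \<Longrightarrow> big (Seq c d) u w"
| big_WhileF: "u r = 0 \<Longrightarrow> big (While r c) u u"
| big_WhileT: "\<lbrakk>u r \<noteq> 0; big c u v; big (While r c) v w\<rbrakk> \<Longrightarrow> big (While r c) u w"

lemma big_Op_eq: "w = apply_op p v \<Longrightarrow> big (Op p) v w"
  by (simp add: big_Op)

definition clear :: "nat \<Rightarrow> com" where
  "clear r = While r (Op (Dec r))"

lemma big_clear: "w = v(r := 0) \<Longrightarrow> big (clear r) v w"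
proof (induction "v r" arbitrary: v)
  case 0
  then have "v(r := 0) = v" by auto
  then show ?case using 0 big_WhileF unfolding clear_def by metis
next
  case (Suc k)
  have "big (Op (Dec r)) v (v(r := k))"
    using Suc.hyps(2) by (intro big_Op_eq) (simp add: fun_eq_iff)
  moreover have "big (clear r) (v(r := k)) w"
    by (rule Suc.hyps(1)) (simp_all add: Suc.prems)
  ultimately show ?case
    using Suc.hyps(2) unfolding clear_def by (auto intro: big_WhileT[where v = "v(r := k)"])
qed

text \<open>The count starts at 0, so \<open>clear_range b 2\<close> clears the three scratch
  registers of the case \<open>Pr\<close>. In the case \<open>Cn\<close> the last register cleared
  is zero already.\<close>

fun clear_range :: "nat \<Rightarrow> nat \<Rightarrow> com" where
  "clear_range b 0 = clear b"
| "clear_range b (Suc n) = Seq (clear_range b n) (clear (b + Suc n))"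

lemma big_clear_range: "w = (\<lambda>j. if b \<le> j \<and> j \<le> b + n then 0 else v j) \<Longrightarrow> big (clear_range b n) v w"
proof (induction n arbitrary: w)
  case 0
  then show ?case by (auto intro!: big_clear simp: fun_eq_iff)
next
  case (Suc n)
  then show ?case
    by (auto intro!: big_Seq[OF Suc.IH[OF refl]] big_clear simp: fun_eq_iff)
qed

section \<open>Compilation of recursive functions into counter programs\<close>

inductive_cases reval_zE: "reval recf.z xs r"
inductive_cases reval_sE: "reval recf.s xs r"
inductive_cases reval_idE: "reval (recf.id n i) xs r"
inductive_cases reval_CnE: "reval (Cn n f gs) xs r"
inductive_cases reval_PrE: "reval (Pr n f g) xs r"
inductive_cases reval_MnE: "reval (Mn n f) xs r"

text \<open>The registers from \<open>b\<close> on are scratch space: zero before and after the run.\<close>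

definition implements :: "com \<Rightarrow> recf \<Rightarrow> nat list \<Rightarrow> nat \<Rightarrow> nat \<Rightarrow> bool" where
  "implements c f ins out b \<longleftrightarrow>
     (\<forall>v r. reval f (map v ins) r \<longrightarrow> (\<forall>j\<ge>b. v j = 0) \<longrightarrow> big c v (v(out := r)))"

lemma implementsD:
  "\<lbrakk>implements c f ins out b; reval f xs r; map v ins = xs; \<forall>j\<ge>b. v j = 0; w = v(out := r)\<rbrakk>
    \<Longrightarrow> big c v w"
proof -
  assume "implements c f ins out b" and r: "reval f xs r" "map v ins = xs"
    and v: "\<forall>j\<ge>b. v j = 0" and w: "w = v(out := r)"
  then have "reval f (map v ins) r \<longrightarrow> (\<forall>j\<ge>b. v j = 0) \<longrightarrow> big c v (v(out := r))"
    unfolding implements_def by (elim allE)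
  then show "big c v w" unfolding w r(2) using r(1) v by iprover
qed

text \<open>Turns the nested derivation into a table of intermediate values, so that the compiled
  loop can compute them upwards from 0.\<close>

lemma reval_Pr_values:
  assumes "reval (Pr n f g) (xs @ [y]) r"
  shows "length xs = n \<and> (\<exists>V. reval f xs (V 0) \<and> (\<forall>i<y. reval g (xs @ [i, V i]) (V (Suc i))) \<and> V y = r)"
  using assms
proof (induction y arbitrary: r)
  case 0
  from 0 show ?case by (cases rule: reval.cases) (auto intro!: exI[of _ "\<lambda>_. r"])
next
  case (Suc y)
  from Suc.prems show ?case
  proof (cases rule: reval.cases)
    case (reval_PrS ys y' r1)
    then have e: "ys = xs" "y' = y" by auto
    obtain V where V: "reval f xs (V 0)" "\<forall>i<y. reval g (xs @ [i, V i]) (V (Suc i))" "V y = r1"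
      using Suc.IH reval_PrS(3) unfolding e by blast
    show ?thesis
      using V reval_PrS unfolding e
      by (intro conjI exI[of _ "V(Suc y := r)"]) (auto simp: less_Suc_eq)
  qed auto
qed

text \<open>The results go to fresh registers \<open>b\<close>, \<open>b + 1\<close>, ..., which
  leaves the inputs intact for the remaining arguments. Each further result pushes the scratch space
  up by one. The assumption \<open>gs\<close> is the induction hypothesis of the compilation
  theorem.\<close>

lemma compile_Cn_args:
  assumes gs: "\<And>g out b. \<lbrakk>g \<in> set gs; \<forall>i\<in>set ins. i < b; out < b\<rbrakk> \<Longrightarrow> \<exists>c. implements c g ins out b"
    and ins: "\<forall>i\<in>set ins. i < b" and k: "k \<le> length gs"
  shows "\<exists>c. \<forall>v ys. length ys = length gs \<longrightarrow> (\<forall>j<length gs. reval (gs ! j) (map v ins) (ys ! j)) \<longrightarrow>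
     (\<forall>j\<ge>b. v j = 0) \<longrightarrow> big c v (\<lambda>j. if b \<le> j \<and> j < b + k then ys ! (j - b) else v j)"
  using k
proof (induction k)
  case 0
  show ?case
    \<comment> \<open>Copying a register to itself serves as the empty program.\<close>
    by (intro exI[of _ "Op (Cpy 0 0)"]) (auto intro!: big_Op_eq)
next
  case (Suc k)
  then obtain c where c: "\<And>v ys. \<lbrakk>length ys = length gs; \<forall>j<length gs. reval (gs ! j) (map v ins) (ys ! j);
     \<forall>j\<ge>b. v j = 0\<rbrakk> \<Longrightarrow> big c v (\<lambda>j. if b \<le> j \<and> j < b + k then ys ! (j - b) else v j)"
    by auto
  obtain d where d: "implements d (gs ! k) ins (b + k) (b + Suc k)"
    using gs[of "gs ! k" "b + Suc k" "b + k"] ins Suc.prems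
    by (auto simp: less_Suc_eq trans_less_add1)
  show ?case
  proof (intro exI[of _ "Seq c d"] allI impI)
    fix v ys
    assume l: "length ys = length gs" and r: "\<forall>j<length gs. reval (gs ! j) (map v ins) (ys ! j)"
      and v: "\<forall>j\<ge>b. v j = 0"
    let ?w = "\<lambda>j. if b \<le> j \<and> j < b + k then ys ! (j - b) else v j"
    have "map ?w ins = map v ins" using ins by auto
    then show "big (Seq c d) v (\<lambda>j. if b \<le> j \<and> j < b + Suc k then ys ! (j - b) else v j)"
      using r Suc.prems v
      by (intro big_Seq[OF c[OF l r v]] implementsD[OF d, where r = "ys ! k" and xs = "map v ins"])
        (auto simp: fun_eq_iff less_Suc_eq)
  qed
qed

text \<open>Only convergence has to be simulated, since \<open>implements\<close> demands nothing
  where \<open>f\<close> has no value. The bound \<open>b\<close> is arbitrary in the induction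
  because subprograms need scratch space above the registers in use.\<close>

theorem compile:
  "\<lbrakk>\<forall>i\<in>set ins. i < b; out < b\<rbrakk> \<Longrightarrow> \<exists>c. implements c f ins out b"
proof (induction f arbitrary: ins out b)
  case z
  have "implements (clear out) z ins out b"
    unfolding implements_def by (auto elim: reval_zE intro!: big_clear)
  then show ?case by blast
next
  case s
  have "implements (Seq (Op (Cpy out (ins ! 0))) (Op (Inc out))) s ins out b"
    unfolding implements_def
    by (auto elim!: reval_sE intro!: big_Seq[OF big_Op] big_Op_eq)
  then show ?case by blast
next
  case (id n i)
  have "implements (Op (Cpy out (ins ! i))) (recf.id n i) ins out b"
    unfolding implements_def
    by (auto elim!: reval_idE intro!: big_Op_eq)
  then show ?case by blast
next
  case (Cn n f gs)
  let ?l = "length gs"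
  obtain c where c: "\<And>v ys. \<lbrakk>length ys = ?l; \<forall>j<?l. reval (gs ! j) (map v ins) (ys ! j);
     \<forall>j\<ge>b. v j = 0\<rbrakk> \<Longrightarrow> big c v (\<lambda>j. if b \<le> j \<and> j < b + ?l then ys ! (j - b) else v j)"
    using compile_Cn_args[OF Cn.IH(2) Cn.prems(1) order_refl] by blast
  have "\<exists>d. implements d f [b..<b + ?l] out (b + ?l)"
    by (rule Cn.IH(1)) (use Cn.prems in auto)
  then obtain d where d: "implements d f [b..<b + ?l] out (b + ?l)"
    by blast
  have "implements (Seq (Seq c d) (clear_range b ?l)) (Cn n f gs) ins out b"
    unfolding implements_def
  proof (intro allI impI)
    fix v r assume r: "reval (Cn n f gs) (map v ins) r" and v: "\<forall>j\<ge>b. v j = 0"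
    from r obtain ys where ys: "length ys = ?l" "\<forall>k<?l. reval (gs ! k) (map v ins) (ys ! k)" "reval f ys r"
      by (rule reval_CnE)
    let ?w = "\<lambda>j. if b \<le> j \<and> j < b + ?l then ys ! (j - b) else v j"
    have m: "map ?w [b..<b + ?l] = ys" by (rule nth_equalityI) (simp_all add: ys(1))
    have w: "\<forall>j\<ge>b + ?l. ?w j = 0" using v by auto
    have "big d ?w (?w(out := r))" by (rule implementsD[OF d ys(3) m w refl])
    moreover have "big (clear_range b ?l) (?w(out := r)) (v(out := r))"
      using v Cn.prems(2) by (intro big_clear_range) (simp add: fun_eq_iff)
    ultimately show "big (Seq (Seq c d) (clear_range b ?l)) v (v(out := r))"
      by (rule big_Seq[OF big_Seq[OF c[OF ys(1,2) v]]])
  qed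
  then show ?case by blast
next
  case (Pr n f g)
  show ?case
  proof (cases ins rule: rev_cases)
    case Nil
    \<comment> \<open>\<open>Pr\<close> has no value on the empty argument list, so any program will
      do.\<close>
    have "implements (clear 0) (Pr n f g) ins out b"
      unfolding implements_def Nil by (auto elim: reval_PrE)
    then show ?thesis by blast
  next
    case (snoc js iy)
    have ib: "\<forall>i\<in>set js. i < b" "iy < b" using Pr.prems snoc by auto
    have "\<exists>cf. implements cf f js (b + 2) (b + 3)"
      by (rule Pr.IH(1)) (use ib in \<open>auto simp: trans_less_add1\<close>)
    then obtain cf where cf: "implements cf f js (b + 2) (b + 3)"
      by blast
    have "\<exists>cg. implements cg g (js @ [b + 1, b + 2]) (b + 2) (b + 3)"
      by (rule Pr.IH(2)) (use ib in \<open>auto simp: trans_less_add1\<close>)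
    then obtain cg where cg: "implements cg g (js @ [b + 1, b + 2]) (b + 2) (b + 3)"
      by blast
    \<comment> \<open>Register \<open>b\<close> counts the remaining rounds, \<open>b + 1\<close>
      holds the index of the recursion and \<open>b + 2\<close> the value reached so far.\<close>
    let ?body = "Seq cg (Seq (Op (Inc (b + 1))) (Op (Dec b)))"
    let ?c = "Seq (Seq cf (Seq (Op (Cpy b iy)) (While b ?body))) (Seq (Op (Cpy out (b + 2))) (clear_range b 2))"
    have "implements ?c (Pr n f g) ins out b"
      unfolding implements_def
    proof (intro allI impI)
      fix v r assume r: "reval (Pr n f g) (map v ins) r" and v: "\<forall>j\<ge>b. v j = 0"
      let ?xs = "map v js"
      obtain V where V: "reval f ?xs (V 0)" "\<And>i. i < v iy \<Longrightarrow> reval g (?xs @ [i, V i]) (V (Suc i))"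
        "V (v iy) = r"
        using reval_Pr_values[of n f g ?xs "v iy" r] r snoc by auto
      let ?w = "\<lambda>i. v(b := v iy - i, b + 1 := i, b + 2 := V i)"
      have loop: "big (While b ?body) (?w (v iy - k)) (?w (v iy))" if "k \<le> v iy" for k
        using that
      proof (induction k)
        case 0
        then show ?case by (auto intro: big_WhileF)
      next
        case (Suc k)
        let ?i = "v iy - Suc k"
        have "big cg (?w ?i) ((?w ?i)(b + 2 := V (Suc ?i)))"
          by (rule implementsD[OF cg V(2)[of ?i]]) (use Suc.prems ib v in auto)
        moreover have "Suc ?i = v iy - k" using Suc.prems by simp
        ultimately have body: "big ?body (?w ?i) (?w (v iy - k))"
          using Suc.prems
          by (intro big_Seq[of cg, OF _ big_Seq[OF big_Op big_Op_eq]]) (assumption, simp add: fun_eq_iff)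
        have nz: "?w ?i b \<noteq> 0" and le: "k \<le> v iy" using Suc.prems by auto
        show ?case by (rule big_WhileT[OF nz body Suc.IH[OF le]])
      qed
      have "big cf v (v(b + 2 := V 0))"
        by (rule implementsD[OF cf V(1)]) (use v in auto)
      moreover have "big (Op (Cpy b iy)) (v(b + 2 := V 0)) (?w 0)"
        using ib v by (intro big_Op_eq) (auto simp: fun_eq_iff)
      moreover have "big (While b ?body) (?w 0) (?w (v iy))" using loop[of "v iy"] by simp
      moreover have "big (Seq (Op (Cpy out (b + 2))) (clear_range b 2)) (?w (v iy)) (v(out := r))"
        using V(3) Pr.prems v by (intro big_Seq[OF big_Op] big_clear_range) (auto simp: fun_eq_iff)
      ultimately show "big ?c v (v(out := r))"
        by (rule big_Seq[OF big_Seq[OF _ big_Seq]])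
    qed
    then show ?thesis by blast
  qed
next
  case (Mn n f)
  have "\<exists>cf. implements cf f (ins @ [b]) (b + 1) (b + 2)"
    by (rule Mn.IH) (use Mn.prems in \<open>auto simp: trans_less_add1\<close>)
  then obtain cf where cf: "implements cf f (ins @ [b]) (b + 1) (b + 2)"
    by blast
  \<comment> \<open>Register \<open>b\<close> holds the candidate and \<open>b + 1\<close> the value
    of \<open>f\<close> there; this value is computed once before the loop to have a test for
    candidate 0.\<close>
  let ?body = "Seq (Op (Inc b)) cf"
  let ?c = "Seq (Seq cf (While (b + 1) ?body)) (Seq (Op (Cpy out b)) (clear b))"
  have "implements ?c (Mn n f) ins out b"
    unfolding implements_def
  proof (intro allI impI)
    fix v r assume r: "reval (Mn n f) (map v ins) r" and v: "\<forall>j\<ge>b. v j = 0"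
    let ?xs = "map v ins"
    have r0: "reval f (?xs @ [r]) 0" and pos: "\<forall>i<r. \<exists>u. reval f (?xs @ [i]) u \<and> 0 < u"
      using r by (auto elim: reval_MnE)
    from pos obtain U where U: "\<And>i. i < r \<Longrightarrow> reval f (?xs @ [i]) (U i) \<and> 0 < U i" by metis
    define V where "V i = (if i < r then U i else 0)" for i
    have V: "reval f (?xs @ [i]) (V i)" if "i \<le> r" for i
      using that U r0 by (cases "i = r") (auto simp: V_def)
    let ?w = "\<lambda>i. v(b := i, b + 1 := V i)"
    have step: "big cf (v(b := i, b + 1 := u)) (?w i)" if "i \<le> r" for i u
      by (rule implementsD[OF cf V[OF that]]) (use Mn.prems v in auto)
    have loop: "big (While (b + 1) ?body) (?w (r - k)) (?w r)" if "k \<le> r" for k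
      using that
    proof (induction k)
      case 0
      then show ?case by (auto intro: big_WhileF simp: V_def)
    next
      case (Suc k)
      have e: "Suc (r - Suc k) = r - k" using Suc.prems by simp
      have "big (Op (Inc b)) (?w (r - Suc k)) (v(b := r - k, b + 1 := V (r - Suc k)))"
        by (rule big_Op_eq) (simp add: fun_eq_iff flip: e)
      then have body: "big ?body (?w (r - Suc k)) (?w (r - k))"
        by (rule big_Seq[OF _ step]) simp
      have nz: "?w (r - Suc k) (b + 1) \<noteq> 0" and le: "k \<le> r"
        using Suc.prems U[of "r - Suc k"] by (auto simp: V_def)
      show ?case by (rule big_WhileT[OF nz body Suc.IH[OF le]])
    qed
    have "v = v(b := 0, b + 1 := 0)" using v by auto
    then have "big cf v (?w 0)" using step[of 0 0] by simp
    moreover have "big (While (b + 1) ?body) (?w 0) (?w r)" using loop[of r] by simp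
    moreover have "big (Seq (Op (Cpy out b)) (clear b)) (?w r) (v(out := r))"
      using Mn.prems v by (intro big_Seq[OF big_Op] big_clear) (auto simp: fun_eq_iff V_def)
    ultimately show "big ?c v (v(out := r))"
      by (rule big_Seq[OF big_Seq])
  qed
  then show ?case by blast
qed

text \<open>The control state of a running program is the list of statements still to be executed; only
  finitely many such lists are reachable (\<open>conts\<close> below).\<close>

fun next_cont :: "com list \<Rightarrow> nat set \<Rightarrow> com list" where
  "next_cont [] P = []"
| "next_cont (Op p # k) P = k"
| "next_cont (Seq c d # k) P = c # d # k"
| "next_cont (While r c # k) P = (if r \<in> P then c # While r c # k else k)"

fun next_regs :: "com list \<Rightarrow> (nat \<Rightarrow> nat) \<Rightarrow> nat \<Rightarrow> nat" where
  "next_regs (Op p # k) v = apply_op p v"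
| "next_regs k v = v"

text \<open>The control part depends on the registers only through the set of nonzero ones. That set
  is exactly what the tile in column 0 shows.\<close>

fun step :: "com list \<times> (nat \<Rightarrow> nat) \<Rightarrow> com list \<times> (nat \<Rightarrow> nat)" where
  "step (k, v) = (next_cont k {r. 0 < v r}, next_regs k v)"

definition start :: "com \<Rightarrow> nat \<Rightarrow> com list \<times> (nat \<Rightarrow> nat)" where
  "start c x = ([c], (\<lambda>_. 0)(0 := x))"

definition halts :: "com \<Rightarrow> nat \<Rightarrow> bool" where
  "halts c x \<longleftrightarrow> (\<exists>n. fst ((step ^^ n) (start c x)) = [])"

lemma funpow_trans: "\<lbrakk>(f ^^ m) a = b; (f ^^ n) b = c\<rbrakk> \<Longrightarrow> \<exists>l. (f ^^ l) a = c"
  by (intro exI[of _ "n + m"]) (simp add: funpow_add)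

lemma big_imp_steps: "big c v w \<Longrightarrow> \<exists>n. (step ^^ n) (c # k, v) = (k, w)"
proof (induction arbitrary: k rule: big.induct)
  case (big_Op p v)
  show ?case by (intro exI[of _ 1]) simp
next
  case (big_Seq c u v d w)
  have "(step ^^ 1) (Seq c d # k, u) = (c # d # k, u)" by simp
  then show ?case using big_Seq.IH funpow_trans by metis
next
  case (big_WhileF u r c)
  then show ?case by (intro exI[of _ 1]) simp
next
  case (big_WhileT u r c v w)
  then have "(step ^^ 1) (While r c # k, u) = (c # While r c # k, u)" by simp
  then show ?case using big_WhileT.IH funpow_trans by metis
qed

lemma halted_stays: "fst a = [] \<Longrightarrow> fst ((step ^^ n) a) = []"
proof (induction n)
  case (Suc n)
  then show ?case by (cases "(step ^^ n) a") simp
qed simp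

lemma halts_from:
  assumes "(step ^^ m) (start c x) = a"
  shows "halts c x \<longleftrightarrow> (\<exists>n. fst ((step ^^ n) a) = [])"
proof
  assume "halts c x"
  then obtain n where n: "fst ((step ^^ n) (start c x)) = []" unfolding halts_def by blast
  have "(step ^^ n) a = (step ^^ m) ((step ^^ n) (start c x))"
    unfolding assms[symmetric] by (simp add: funpow_add[THEN fun_cong, simplified, symmetric] add.commute)
  then show "\<exists>n. fst ((step ^^ n) a) = []" using halted_stays[OF n, of m] by metis
next
  assume "\<exists>n. fst ((step ^^ n) a) = []"
  then show "halts c x" unfolding halts_def using funpow_trans[OF assms] by metis
qed

text \<open>The program computes the value \<open>r\<close>, leaves \<open>1 - r\<close> in register
  2 and then idles as long as that register is nonzero. So rejection becomes divergence.\<close>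

theorem halting_machine:
  obtains c where "\<And>x r. \<lbrakk>reval h [x] r; r \<le> 1\<rbrakk> \<Longrightarrow> halts c (Suc x) \<longleftrightarrow> r = 1"
proof -
  obtain d where d: "implements d h [0] 1 2"
    using compile[of "[0]" 2 1 h] by auto
  let ?idle = "Op (Cpy 2 2)"
  \<comment> \<open>Since \<open>r\<close> is at most 1, the inner loop runs at most once; it
    subtracts \<open>r\<close> from the 1 just put into register 2.\<close>
  let ?c1 = "Seq (Op (Dec 0)) (Seq d (Seq (Op (Inc 2)) (While 1 (Seq (Op (Dec 1)) (Op (Dec 2))))))"
  let ?loop = "While 2 ?idle"
  let ?c = "Seq ?c1 ?loop"
  show ?thesis
  proof (rule that[of ?c])
    \<comment> \<open>The first statement turns the input \<open>Suc x\<close> into \<open>x\<close>: tilings represent a positive input, as column 0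
      is not one of the \<open>x\<close> chain states.\<close>
    fix x r assume r: "reval h [x] r" and "r \<le> 1"
    let ?v = "((\<lambda>_. 0)(0 := x)) :: nat \<Rightarrow> nat"
    let ?w = "?v(2 := 1 - r)"
    have 1: "big (Op (Dec 0)) ((\<lambda>_. 0)(0 := Suc x)) ?v" by (rule big_Op_eq) auto
    have 2: "big d ?v (?v(1 := r))" by (rule implementsD[OF d r]) auto
    have 3: "big (Op (Inc 2)) (?v(1 := r)) (?v(1 := r, 2 := 1))" by (rule big_Op_eq) auto
    have 4: "big (While 1 (Seq (Op (Dec 1)) (Op (Dec 2)))) (?v(1 := r, 2 := 1)) ?w"
    proof (cases "r = 0")
      case True
      have "?v(1 := r, 2 := 1) = ?w" using True by (simp add: fun_eq_iff)
      then show ?thesis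
        using big_WhileF[of ?w 1 "Seq (Op (Dec 1)) (Op (Dec 2))"] by simp
    next
      case False
      then have [simp]: "r = 1" using \<open>r \<le> 1\<close> by simp
      have "big (Op (Dec 1)) (?v(1 := r, 2 := 1)) (?v(2 := 1))" by (rule big_Op_eq) auto
      moreover have "big (Op (Dec 2)) (?v(2 := 1)) ?w" by (rule big_Op_eq) auto
      ultimately have "big (Seq (Op (Dec 1)) (Op (Dec 2))) (?v(1 := r, 2 := 1)) ?w" by (rule big_Seq)
      then show ?thesis by (rule big_WhileT[rotated]) (auto intro: big_WhileF)
    qed
    have "big ?c1 ((\<lambda>_. 0)(0 := Suc x)) ?w"
      by (rule big_Seq[OF 1 big_Seq[OF 2 big_Seq[OF 3 4]]])
    from big_imp_steps[OF this, of "[?loop]"] obtain n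
      where n: "(step ^^ n) (?c1 # [?loop], (\<lambda>_. 0)(0 := Suc x)) = ([?loop], ?w)" by blast
    have "(step ^^ 1) (start ?c (Suc x)) = (?c1 # [?loop], (\<lambda>_. 0)(0 := Suc x))"
      by (simp add: start_def)
    from funpow_trans[OF this n] obtain m where m: "(step ^^ m) (start ?c (Suc x)) = ([?loop], ?w)"
      by blast
    show "halts ?c (Suc x) \<longleftrightarrow> r = 1"
    proof (cases "r = 1")
      case True
      have "fst ((step ^^ 1) ([?loop], ?w)) = []" using True by simp
      then show ?thesis unfolding halts_from[OF m] using True by blast
    next
      case False
      then have [simp]: "r = 0" using \<open>r \<le> 1\<close> by simp
      \<comment> \<open>Idling alternates between two configurations, neither of which has an empty
        control state.\<close>
      have "(step ^^ n) ([?loop], ?w) \<in> {([?loop], ?w), ([?idle, ?loop], ?w)}" for n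
        by (induction n) (auto simp: fun_eq_iff)
      then have "fst ((step ^^ n) ([?loop], ?w)) \<noteq> []" for n
        by (metis (no_types, lifting) fst_conv insertE list.distinct(1) singletonD)
      then show ?thesis unfolding halts_from[OF m] by simp
    qed
  qed
qed

fun conts :: "com \<Rightarrow> com list \<Rightarrow> com list set" where
  "conts (Op p) k = {Op p # k, k}"
| "conts (Seq c d) k = {Seq c d # k} \<union> conts c (d # k) \<union> conts d k"
| "conts (While r c) k = {While r c # k, k} \<union> conts c (While r c # k)"

lemma finite_conts: "finite (conts c k)"
  by (induction c arbitrary: k) auto

lemma conts_first: "c # k \<in> conts c k"
  by (cases c) auto

lemma conts_last: "k \<in> conts c k"
  by (induction c arbitrary: k) auto

text \<open>Execution of \<open>c\<close> on top of \<open>k\<close> leaves the set only by working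
  on \<open>k\<close> itself, hence the exception. For \<open>k = []\<close> the exception is
  harmless, because the empty list is its own successor.\<close>

lemma next_cont_conts: "l \<in> conts c k \<Longrightarrow> l = k \<or> next_cont l P \<in> conts c k"
proof (induction c arbitrary: k l)
  case (Seq c d)
  have "l = Seq c d # k \<or> l \<in> conts c (d # k) \<or> l \<in> conts d k" using Seq.prems by auto
  then show ?case
  proof (elim disjE)
    assume "l \<in> conts c (d # k)"
    then have "l = d # k \<or> next_cont l P \<in> conts c (d # k)" by (rule Seq.IH(1))
    moreover have "d # k = k \<or> next_cont (d # k) P \<in> conts d k" by (rule Seq.IH(2)[OF conts_first])
    ultimately show ?thesis by auto
  qed (use Seq.IH(2) conts_first in auto)
next
  case (While r c)
  have "l = k \<or> l = While r c # k \<or> l \<in> conts c (While r c # k)" using While.prems by auto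
  then show ?case
    using While.IH[of l "While r c # k"] conts_first[of c "While r c # k"] by auto
qed auto

fun regs_of :: "com \<Rightarrow> nat set" where
  "regs_of (Op (Inc r)) = {r}"
| "regs_of (Op (Dec r)) = {r}"
| "regs_of (Op (Cpy r q)) = {r, q}"
| "regs_of (Seq c d) = regs_of c \<union> regs_of d"
| "regs_of (While r c) = {r} \<union> regs_of c"

lemma finite_regs_of: "finite (regs_of c)"
  by (induction c rule: regs_of.induct) auto

lemma conts_regs: "l \<in> conts c k \<Longrightarrow> \<Union> (regs_of ` set l) \<subseteq> regs_of c \<union> \<Union> (regs_of ` set k)"
  by (induction c arbitrary: k l) fastforce+

section \<open>Tilings\<close>

text \<open>The value 0 is kept free: in \<open>row_type\<close> it means that the tile lies above
  row 0 and has no initial condition.\<close>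

definition col_type :: "nat \<Rightarrow> nat \<Rightarrow> nat" where
  "col_type x a = (if a = 0 then 1 else if a \<le> x then 2 else 3)"

definition tiles :: "('t set) \<Rightarrow> ('t \<Rightarrow> 't \<Rightarrow> bool) \<Rightarrow> ('t \<Rightarrow> 't \<Rightarrow> bool) \<Rightarrow> (nat \<Rightarrow> 't \<Rightarrow> bool) \<Rightarrow> nat
    \<Rightarrow> (nat \<Rightarrow> nat \<Rightarrow> 't) \<Rightarrow> bool" where
  "tiles T H V I x t \<longleftrightarrow>
     (\<forall>a b. t a b \<in> T \<and> H (t a b) (t (Suc a) b) \<and> V (t a b) (t a (Suc b))) \<and>
     (\<forall>a. I (col_type x a) (t a 0))"

text \<open>Row \<open>b\<close> of the tiling is the configuration after \<open>b\<close> steps, with register contents in unary: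
  the tile \<open>(k, B, E, l)\<close> in column \<open>a\<close> holds the control state \<open>k\<close>, the set \<open>B\<close> of registers greater
  than \<open>a\<close>, the set \<open>E\<close> of registers greater than \<open>a + 1\<close>, and the flag \<open>l\<close> marking column 0. Only
  column 0 can see which registers are zero, so only there is the next control state prescribed; the
  horizontal condition carries it through the row.\<close>

type_synonym machine_tile = "com list \<times> nat set \<times> nat set \<times> bool"

text \<open>The set \<open>E\<close> stands for the \<open>B\<close> of the right neighbour, as
  \<open>machine_hor\<close> enforces, so a shift by one column becomes a vertical condition.
  \<open>Inc\<close> moves bits to the right and therefore constrains \<open>E'\<close>; column 0
  has no left neighbour, and there the flag \<open>l\<close> supplies the new bit.\<close>

fun bits_step :: "com list \<Rightarrow> nat set \<Rightarrow> nat set \<Rightarrow> bool \<Rightarrow> nat set \<Rightarrow> nat set \<Rightarrow> bool" where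
  "bits_step (Op (Inc r) # k) B E l B' E' \<longleftrightarrow>
     B' - {r} = B - {r} \<and> (r \<in> E' \<longleftrightarrow> r \<in> B) \<and> (l \<longrightarrow> r \<in> B')"
| "bits_step (Op (Dec r) # k) B E l B' E' \<longleftrightarrow> B' - {r} = B - {r} \<and> (r \<in> B' \<longleftrightarrow> r \<in> E)"
| "bits_step (Op (Cpy r q) # k) B E l B' E' \<longleftrightarrow> B' - {r} = B - {r} \<and> (r \<in> B' \<longleftrightarrow> q \<in> B)"
| "bits_step k B E l B' E' \<longleftrightarrow> B' = B"

fun machine_hor :: "machine_tile \<Rightarrow> machine_tile \<Rightarrow> bool" where
  "machine_hor (k, B, E, l) (k', B', E', l') \<longleftrightarrow> k' = k \<and> B' = E \<and> \<not> l'"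

fun machine_ver :: "machine_tile \<Rightarrow> machine_tile \<Rightarrow> bool" where
  "machine_ver (k, B, E, l) (k', B', E', l') \<longleftrightarrow>
     l' = l \<and> (l \<longrightarrow> k' = next_cont k B) \<and> bits_step k B E l B' E'"

text \<open>Register 0 starts with \<open>Suc x\<close>, so its bit is set in columns 0 to
  \<open>x\<close>, which have types 1 and 2. The flag need not be denied in the other columns, as
  \<open>machine_hor\<close> does this.\<close>

fun machine_init :: "com \<Rightarrow> nat \<Rightarrow> machine_tile \<Rightarrow> bool" where
  "machine_init c i (k, B, E, l) \<longleftrightarrow> B = (if i = 3 then {} else {0}) \<and> (i = 1 \<longrightarrow> l \<and> k = [c])"

text \<open>Leaving out the control state \<open>[]\<close> makes a halting run untileable. Register
  0 is added because it holds the input even if \<open>c\<close> never mentions it.\<close>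

definition machine_tiles :: "com \<Rightarrow> machine_tile set" where
  "machine_tiles c = (conts c [] - {[]}) \<times> Pow (insert 0 (regs_of c)) \<times> Pow (insert 0 (regs_of c)) \<times> UNIV"

lemma finite_machine_tiles: "finite (machine_tiles c)"
  by (simp add: machine_tiles_def finite_conts finite_regs_of)

lemma cont_cases [case_names Inc Dec Cpy Other]:
  obtains r l where "k = Op (Inc r) # l"
  | r l where "k = Op (Dec r) # l"
  | r q l where "k = Op (Cpy r q) # l"
  | "\<And>B E l B' E'. bits_step k B E l B' E' \<longleftrightarrow> B' = B" "\<And>v. next_regs k v = v"
proof (cases k)
  case (Cons c l)
  show ?thesis
  proof (cases c)
    case (Op p)
    then show ?thesis using that(1-3) Cons by (cases p) auto
  qed (use that(4) Cons in auto)
qed (use that(4) in auto)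

lemma bits_step_next_regs:
  "bits_step k {r. a < v r} {r. Suc a < v r} (a = 0) {r. a < next_regs k v r} {r. Suc a < next_regs k v r}"
  by (cases k rule: cont_cases) auto

lemma diff_singleton_memD: "\<lbrakk>A - {r} = A' - {r}; q \<noteq> r\<rbrakk> \<Longrightarrow> q \<in> A \<longleftrightarrow> q \<in> A'"
  by blast

text \<open>For \<open>Inc\<close>, the bit of \<open>r\<close> in column \<open>Suc a\<close> is
  forced by the vertical condition in column \<open>a\<close>, and in column 0 by the flag. For the
  other operations the condition in the column itself suffices.\<close>

lemma bits_step_imp_next_regs:
  assumes step: "\<And>a. bits_step k {r. a < v r} {r. Suc a < v r} (l a) (B a) (B (Suc a))" and l: "l 0"
  shows "B a = {r. a < next_regs k v r}"
proof (cases k rule: cont_cases)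
  case (Inc r k')
  have others: "q \<in> B a \<longleftrightarrow> a < v q" if "q \<noteq> r" for q
  proof -
    have "B a - {r} = {r. a < v r} - {r}" using step[of a] Inc by simp
    then show ?thesis using diff_singleton_memD[OF _ that, of "B a" "{r. a < v r}"] by simp
  qed
  have "r \<in> B a \<longleftrightarrow> a < Suc (v r)"
  proof (cases a)
    case 0
    then show ?thesis using step[of 0] Inc l by simp
  next
    case (Suc a')
    then show ?thesis using step[of a'] Inc by simp
  qed
  then have "q \<in> B a \<longleftrightarrow> a < next_regs k v q" for q
    using others[of q] Inc by (cases "q = r") simp_all
  then show ?thesis by blast
next
  case (Dec r k')
  have "B a - {r} = {r. a < v r} - {r}" "r \<in> B a \<longleftrightarrow> Suc a < v r" using step[of a] Dec by simp_all
  then have "q \<in> B a \<longleftrightarrow> a < next_regs k v q" for q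
    using Dec diff_singleton_memD[of "B a" r "{r. a < v r}" q] by (cases "q = r") (simp_all, linarith)
  then show ?thesis by blast
next
  case (Cpy r q k')
  have "B a - {r} = {r. a < v r} - {r}" "r \<in> B a \<longleftrightarrow> a < v q" using step[of a] Cpy by simp_all
  then have "q \<in> B a \<longleftrightarrow> a < next_regs k v q" for q
    using Cpy diff_singleton_memD[of "B a" r "{r. a < v r}" q] by (cases "q = r") simp_all
  then show ?thesis by blast
next
  case Other
  then show ?thesis using step[of a] by simp
qed

lemma apply_op_positive: "{r. 0 < apply_op p v r} \<subseteq> {r. 0 < v r} \<union> regs_of (Op p)"
  by (cases p) (auto split: if_splits)

lemma run_regs:
  assumes "(step ^^ n) (start c x) = (k, v)"
  shows "k \<in> conts c [] \<and> {r. 0 < v r} \<subseteq> insert 0 (regs_of c)"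
  using assms
proof (induction n arbitrary: k v)
  case 0
  then show ?case using conts_first[of c "[]"] by (auto simp: start_def split: if_splits)
next
  case (Suc n)
  obtain l u where lu: "(step ^^ n) (start c x) = (l, u)" by fastforce
  note IH = Suc.IH[OF lu]
  have kv: "k = next_cont l {r. 0 < u r}" "v = next_regs l u" using Suc.prems lu by auto
  have "k \<in> conts c []"
    using next_cont_conts[of l c "[]" "{r. 0 < u r}"] IH kv conts_last[of "[]" c] by auto
  moreover have "{r. 0 < v r} \<subseteq> insert 0 (regs_of c)"
  proof (cases "(l, u)" rule: next_regs.cases)
    case (1 p k' w)
    then have "regs_of (Op p) \<subseteq> regs_of c" using IH conts_regs[of l c "[]"] by simp
    then show ?thesis using IH 1 apply_op_positive[of p u] unfolding kv(2) by auto
  qed (use IH kv(2) in auto)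
  ultimately show ?case ..
qed

theorem tiling_iff_not_halts:
  "(\<exists>t. tiles (machine_tiles c) machine_hor machine_ver (machine_init c) x t) \<longleftrightarrow> \<not> halts c (Suc x)"
proof
  let ?r = "\<lambda>b. (step ^^ b) (start c (Suc x))"
  assume "\<exists>t. tiles (machine_tiles c) machine_hor machine_ver (machine_init c) x t"
  then obtain t where t: "tiles (machine_tiles c) machine_hor machine_ver (machine_init c) x t" ..
  define K B E l where "K a b = fst (t a b)" and "B a b = fst (snd (t a b))"
    and "E a b = fst (snd (snd (t a b)))" and "l a b = snd (snd (snd (t a b)))" for a b
  then have KB: "t a b = (K a b, B a b, E a b, l a b)" for a b by simp
  have t': "t a b \<in> machine_tiles c" "machine_hor (t a b) (t (Suc a) b)" "machine_ver (t a b) (t a (Suc b))"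
    "machine_init c (col_type x a) (t a 0)" for a b
    using t unfolding tiles_def by blast+
  have H: "K (Suc a) b = K a b" "E a b = B (Suc a) b" for a b
    using t'(2)[of a b] by (simp_all add: KB)
  have V: "l a (Suc b) = l a b" "l a b \<Longrightarrow> K a (Suc b) = next_cont (K a b) (B a b)"
    "bits_step (K a b) (B a b) (E a b) (l a b) (B a (Suc b)) (E a (Suc b))" for a b
    using t'(3)[of a b] by (simp_all add: KB)
  have I: "B a 0 = (if col_type x a = 3 then {} else {0})" "l 0 0" "K 0 0 = [c]" for a
    using t'(4)[of a] t'(4)[of 0] by (simp_all add: KB col_type_def)
  have T: "K a b \<noteq> []" for a b
    using t'(1)[of a b] by (simp add: KB machine_tiles_def)
  have K: "K a b = K 0 b" for a b by (induction a) (simp_all add: H)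
  have l: "l 0 b" for b by (induction b) (simp_all add: V I)
  have "\<exists>v. ?r b = (K 0 b, v) \<and> (\<forall>a. B a b = {r. a < v r})" for b
  proof (induction b)
    case 0
    show ?case by (auto simp: start_def I col_type_def)
  next
    case (Suc b)
    then obtain v where v: "?r b = (K 0 b, v)" "\<And>a. B a b = {r. a < v r}" by blast
    have "bits_step (K 0 b) {r. a < v r} {r. Suc a < v r} (l a b) (B a (Suc b)) (B (Suc a) (Suc b))" for a
      using V(3)[of a b] by (simp only: H(2) v(2) K[of a b])
    from bits_step_imp_next_regs[of _ _ "\<lambda>a. l a b", OF this l]
    have "B a (Suc b) = {r. a < next_regs (K 0 b) v r}" for a .
    moreover have "?r (Suc b) = (K 0 (Suc b), next_regs (K 0 b) v)"
      using v V(2)[OF l, of b] by simp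
    ultimately show ?case by blast
  qed
  then show "\<not> halts c (Suc x)" unfolding halts_def using T by (metis fst_conv)
next
  let ?r = "\<lambda>b. (step ^^ b) (start c (Suc x))"
  assume "\<not> halts c (Suc x)"
  then have nh: "fst (?r b) \<noteq> []" for b unfolding halts_def by blast
  define K v where "K b = fst (?r b)" and "v b = snd (?r b)" for b
  then have r: "?r b = (K b, v b)" for b by simp
  define t where "t a b = (K b, {r. a < v b r}, {r. Suc a < v b r}, a = 0)" for a b :: nat
  have "K (Suc b) = next_cont (K b) {r. 0 < v b r}" "v (Suc b) = next_regs (K b) (v b)" for b
    using r[of "Suc b"] r[of b] by auto
  moreover have "K 0 = [c]" "v 0 = (\<lambda>_. 0)(0 := Suc x)" using r[of 0] by (auto simp: start_def)
  moreover have "t a b \<in> machine_tiles c" for a b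
  proof -
    have "K b \<in> conts c []" "{r. 0 < v b r} \<subseteq> insert 0 (regs_of c)" using run_regs[OF r, of b] by simp_all
    moreover have "{r. a < v b r} \<subseteq> {r. 0 < v b r}" "{r. Suc a < v b r} \<subseteq> {r. 0 < v b r}"
      by (rule Collect_mono, simp)+
    moreover have "K b \<noteq> []" using nh[of b] r[of b] by simp
    ultimately show ?thesis unfolding t_def machine_tiles_def by (simp add: subset_trans)
  qed
  ultimately have "tiles (machine_tiles c) machine_hor machine_ver (machine_init c) x t"
    unfolding tiles_def t_def
    by (auto simp: bits_step_next_regs col_type_def)
  then show "\<exists>t. tiles (machine_tiles c) machine_hor machine_ver (machine_init c) x t" by (rule exI[of _ t])
qed

lemma tiles_enumerate:
  assumes "T = e ` S"
  shows "(\<exists>t. tiles T H V I x t) \<longleftrightarrow>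
    (\<exists>t. tiles S (\<lambda>i j. H (e i) (e j)) (\<lambda>i j. V (e i) (e j)) (\<lambda>k i. I k (e i)) x t)"
proof
  assume "\<exists>t. tiles T H V I x t"
  then obtain t where t: "tiles T H V I x t" ..
  then have "\<exists>i. i \<in> S \<and> e i = t a b" for a b unfolding tiles_def assms by (metis imageE)
  then obtain u where "\<And>a b. u a b \<in> S \<and> e (u a b) = t a b" by metis
  then show "\<exists>t. tiles S (\<lambda>i j. H (e i) (e j)) (\<lambda>i j. V (e i) (e j)) (\<lambda>k i. I k (e i)) x t"
    using t unfolding tiles_def by (intro exI[of _ u]) simp
next
  assume "\<exists>t. tiles S (\<lambda>i j. H (e i) (e j)) (\<lambda>i j. V (e i) (e j)) (\<lambda>k i. I k (e i)) x t"
  then obtain t where "tiles S (\<lambda>i j. H (e i) (e j)) (\<lambda>i j. V (e i) (e j)) (\<lambda>k i. I k (e i)) x t" ..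
  then show "\<exists>t. tiles T H V I x t"
    unfolding tiles_def assms by (intro exI[of _ "\<lambda>a b. e (t a b)"]) simp
qed

theorem halting_to_tiling:
  obtains n H V I where "n > 0" "\<And>x. (\<exists>t. tiles {..<n::nat} H V I x t) \<longleftrightarrow> \<not> halts c (Suc x)"
proof -
  obtain m and e :: "nat \<Rightarrow> machine_tile" where e: "machine_tiles c = e ` {i. i < m}"
    using finite_imp_nat_seg_image_inj_on[OF finite_machine_tiles] by metis
  \<comment> \<open>Any tile would do: a player that is asked must have at least one possible
    answer.\<close>
  have "([c], {}, {}, False) \<in> machine_tiles c" by (simp add: machine_tiles_def conts_first)
  then have "0 < m" using e by (cases m) auto
  moreover have "(\<exists>t. tiles {..<m} (\<lambda>i j. machine_hor (e i) (e j)) (\<lambda>i j. machine_ver (e i) (e j)) (\<lambda>k i. machine_init c k (e i)) x t)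
      \<longleftrightarrow> \<not> halts c (Suc x)" for x
    unfolding tiling_iff_not_halts[symmetric] tiles_enumerate[OF e] lessThan_def ..
  ultimately show ?thesis by (rule that)
qed

section \<open>Closure properties of recursive functions\<close>

definition recursive :: "nat \<Rightarrow> (nat list \<Rightarrow> nat) \<Rightarrow> bool" where
  "recursive k F \<longleftrightarrow> (\<exists>p. \<forall>xs. length xs = k \<longrightarrow> reval p xs (F xs))"

lemma recursive_arg: "i < k \<Longrightarrow> recursive k (\<lambda>xs. xs ! i)"
  unfolding recursive_def by (blast intro: reval_id)

lemma recursive_comp:
  assumes "recursive (length Gs) F" and "\<forall>G\<in>set Gs. recursive k G"
  shows "recursive k (\<lambda>xs. F (map (\<lambda>G. G xs) Gs))"
proof -
  obtain p where p: "\<And>ys. length ys = length Gs \<Longrightarrow> reval p ys (F ys)"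
    using assms(1) unfolding recursive_def by blast
  obtain q where q: "\<And>G xs. \<lbrakk>G \<in> set Gs; length xs = k\<rbrakk> \<Longrightarrow> reval (q G) xs (G xs)"
    using assms(2) unfolding recursive_def by metis
  have "reval (Cn k p (map q Gs)) xs (F (map (\<lambda>G. G xs) Gs))" if "length xs = k" for xs
    using that by (intro reval_Cn[where ys = "map (\<lambda>G. G xs) Gs"] p) (auto intro: q)
  then show ?thesis unfolding recursive_def by blast
qed

lemma recursive_comp1:
  "\<lbrakk>recursive 1 (\<lambda>xs. f (xs ! 0)); recursive k G\<rbrakk> \<Longrightarrow> recursive k (\<lambda>xs. f (G xs))"
  using recursive_comp[of "[G]" "\<lambda>xs. f (xs ! 0)" k] by simp

lemma recursive_comp2:
  "\<lbrakk>recursive 2 (\<lambda>xs. f (xs ! 0) (xs ! 1)); recursive k G; recursive k H\<rbrakk>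
    \<Longrightarrow> recursive k (\<lambda>xs. f (G xs) (H xs))"
  using recursive_comp[of "[G, H]" "\<lambda>xs. f (xs ! 0) (xs ! 1)" k] by (simp add: numeral_2_eq_2)

lemma recursive_Suc: "recursive k G \<Longrightarrow> recursive k (\<lambda>xs. Suc (G xs))"
proof (rule recursive_comp1[of Suc])
  have "reval recf.s xs (Suc (xs ! 0))" if "length xs = 1" for xs
    using that by (auto simp: length_Suc_conv intro: reval_s)
  then show "recursive 1 (\<lambda>xs. Suc (xs ! 0))" unfolding recursive_def by blast
qed

lemma recursive_const: "0 < k \<Longrightarrow> recursive k (\<lambda>_. c)"
proof (induction c)
  case 0
  have "reval recf.z xs 0" if "length xs = 1" for xs
    using that by (auto simp: length_Suc_conv intro: reval_z)
  then have "recursive 1 (\<lambda>_. 0)" unfolding recursive_def by blast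
  from recursive_comp1[of "\<lambda>_. 0", OF this recursive_arg[OF 0]] show ?case .
qed (use recursive_Suc in blast)

lemma recursive_Pr:
  assumes "recursive k B" and "recursive (Suc (Suc k)) E"
  shows "recursive (Suc k) (\<lambda>xs. rec_nat (B (butlast xs)) (\<lambda>i v. E (butlast xs @ [i, v])) (last xs))"
proof -
  obtain p where p: "\<And>ys. length ys = k \<Longrightarrow> reval p ys (B ys)"
    using assms(1) unfolding recursive_def by blast
  obtain q where q: "\<And>ys. length ys = Suc (Suc k) \<Longrightarrow> reval q ys (E ys)"
    using assms(2) unfolding recursive_def by blast
  have "reval (Pr k p q) (ys @ [n]) (rec_nat (B ys) (\<lambda>i v. E (ys @ [i, v])) n)" if "length ys = k" for ys n
  proof (induction n)
    case 0
    show ?case using reval_Pr0[OF that p[OF that]] by simp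
  next
    case (Suc n)
    show ?case using reval_PrS[OF that Suc q] that by simp
  qed
  then have "reval (Pr k p q) xs (rec_nat (B (butlast xs)) (\<lambda>i v. E (butlast xs @ [i, v])) (last xs))"
    if "length xs = Suc k" for xs
    using that by (cases xs rule: rev_cases) auto
  then show ?thesis unfolding recursive_def by blast
qed

lemma length_2_conv: "length xs = 2 \<longleftrightarrow> (\<exists>a b. xs = [a, b])"
  by (auto simp: length_Suc_conv numeral_2_eq_2)

lemma recursive_cong:
  "\<lbrakk>recursive k F; \<And>xs. length xs = k \<Longrightarrow> F xs = G xs\<rbrakk> \<Longrightarrow> recursive k G"
  unfolding recursive_def by metis

lemma recursive_rec_nat:
  assumes "recursive 1 (\<lambda>xs. b (xs ! 0))" and "recursive 3 (\<lambda>xs. e (xs ! 0) (xs ! 1) (xs ! 2))"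
    and "recursive k X" "recursive k N"
  shows "recursive k (\<lambda>xs. rec_nat (b (X xs)) (e (X xs)) (N xs))"
proof -
  have "recursive 2 (\<lambda>xs. rec_nat (b (butlast xs ! 0))
    (\<lambda>i v. e ((butlast xs @ [i, v]) ! 0) ((butlast xs @ [i, v]) ! 1) ((butlast xs @ [i, v]) ! 2)) (last xs))"
    using recursive_Pr[OF assms(1), of "\<lambda>xs. e (xs ! 0) (xs ! 1) (xs ! 2)"] assms(2)
    by (simp add: numeral_2_eq_2 numeral_3_eq_3)
  then have "recursive 2 (\<lambda>xs. rec_nat (b (xs ! 0)) (e (xs ! 0)) (xs ! 1))"
    by (rule recursive_cong) (auto simp: length_2_conv)
  from recursive_comp2[OF this assms(3,4)] show ?thesis .
qed

lemma recursive_add: "\<lbrakk>recursive k A; recursive k B\<rbrakk> \<Longrightarrow> recursive k (\<lambda>xs. A xs + B xs)"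
proof -
  have e: "a + b = rec_nat a (\<lambda>_ v. Suc v) b" for a b by (induction b) auto
  show "\<lbrakk>recursive k A; recursive k B\<rbrakk> \<Longrightarrow> recursive k (\<lambda>xs. A xs + B xs)"
    unfolding e
    by (rule recursive_rec_nat[of "\<lambda>a. a" "\<lambda>_ _ v. Suc v"]) (simp_all add: recursive_Suc recursive_arg)
qed

lemma recursive_pred: "recursive k A \<Longrightarrow> recursive k (\<lambda>xs. A xs - 1)"
proof -
  have e: "a - 1 = rec_nat 0 (\<lambda>i _. i) a" for a by (cases a) auto
  show "recursive k A \<Longrightarrow> recursive k (\<lambda>xs. A xs - 1)"
    unfolding e
    by (rule recursive_rec_nat[of "\<lambda>_. 0" "\<lambda>_ i _. i"]) (simp_all add: recursive_const recursive_arg)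
qed

lemma recursive_diff: "\<lbrakk>recursive k A; recursive k B\<rbrakk> \<Longrightarrow> recursive k (\<lambda>xs. A xs - B xs)"
proof -
  have e: "a - b = rec_nat a (\<lambda>_ v. v - 1) b" for a b by (induction b) auto
  show "\<lbrakk>recursive k A; recursive k B\<rbrakk> \<Longrightarrow> recursive k (\<lambda>xs. A xs - B xs)"
    using recursive_rec_nat[of "\<lambda>a. a" "\<lambda>_ _ v. v - 1" k A B]
      recursive_pred[of 3 "\<lambda>xs. xs ! 2"]
    unfolding e[symmetric] by (simp add: recursive_arg)
qed

lemma recursive_min: "\<lbrakk>recursive k A; recursive k B\<rbrakk> \<Longrightarrow> recursive k (\<lambda>xs. min (A xs) (B xs))"
proof -
  have e: "min a b = a - (a - b)" for a b :: nat by auto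
  show "\<lbrakk>recursive k A; recursive k B\<rbrakk> \<Longrightarrow> recursive k (\<lambda>xs. min (A xs) (B xs))"
    unfolding e by (intro recursive_diff)
qed

lemma recursive_triangle: "recursive k A \<Longrightarrow> recursive k (\<lambda>xs. triangle (A xs))"
proof -
  have e: "triangle a = rec_nat 0 (\<lambda>i v. v + Suc i) a" for a by (induction a) auto
  show "recursive k A \<Longrightarrow> recursive k (\<lambda>xs. triangle (A xs))"
    unfolding e
    by (rule recursive_rec_nat[of "\<lambda>_. 0" "\<lambda>_ i v. v + Suc i"])
      (auto intro: recursive_const simp del: add_Suc_right intro!: recursive_arg recursive_add recursive_Suc)
qed

lemma recursive_prod_encode:
  "\<lbrakk>recursive k A; recursive k B\<rbrakk> \<Longrightarrow> recursive k (\<lambda>xs. prod_encode (A xs, B xs))"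
  unfolding prod_encode_def prod.case by (intro recursive_add recursive_triangle)

lemma recursive_Least:
  assumes "recursive (Suc k) F" and "\<And>xs. length xs = k \<Longrightarrow> \<exists>r. F (xs @ [r]) = 0"
  shows "recursive k (\<lambda>xs. LEAST r. F (xs @ [r]) = 0)"
proof -
  obtain p where p: "\<And>ys. length ys = Suc k \<Longrightarrow> reval p ys (F ys)"
    using assms(1) unfolding recursive_def by blast
  have "reval (Mn k p) xs (LEAST r. F (xs @ [r]) = 0)" (is "reval _ _ ?l") if l: "length xs = k" for xs
  proof (rule reval_Mn[OF l])
    have "F (xs @ [?l]) = 0" using assms(2)[OF l] by (rule LeastI_ex)
    then show "reval p (xs @ [?l]) 0" using p[of "xs @ [?l]"] l by simp
    show "\<forall>i<?l. \<exists>v. reval p (xs @ [i]) v \<and> 0 < v"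
    proof (intro allI impI)
      fix i assume "i < ?l"
      then have "0 < F (xs @ [i])" using not_less_Least by blast
      then show "\<exists>v. reval p (xs @ [i]) v \<and> 0 < v" using p[of "xs @ [i]"] l by auto
    qed
  qed
  then show ?thesis unfolding recursive_def by blast
qed

lemma triangle_mono: "m \<le> n \<Longrightarrow> triangle m \<le> triangle n"
  unfolding triangle_def by (intro div_le_mono mult_le_mono) auto

text \<open>The inverse of \<open>triangle\<close>, rounded down: the index of the diagonal of the
  Cantor pairing on which \<open>x\<close> lies. The vanishing truncated difference says that
  \<open>x\<close> is below \<open>triangle (Suc w)\<close>.\<close>

definition tri_root :: "nat \<Rightarrow> nat" where
  "tri_root x = (LEAST w. Suc x - triangle (Suc w) = 0)"

lemma tri_root_prod_encode: "tri_root (prod_encode (a, b)) = a + b"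
  unfolding tri_root_def
proof (rule Least_equality)
  show "Suc (prod_encode (a, b)) - triangle (Suc (a + b)) = 0" by (simp add: prod_encode_def)
  fix w assume w: "Suc (prod_encode (a, b)) - triangle (Suc w) = 0"
  show "a + b \<le> w"
  proof (rule ccontr)
    assume "\<not> a + b \<le> w"
    then have "triangle (Suc w) \<le> triangle (a + b)" by (intro triangle_mono) simp
    then show False using w by (simp add: prod_encode_def)
  qed
qed

lemma recursive_tri_root: "recursive k A \<Longrightarrow> recursive k (\<lambda>xs. tri_root (A xs))"
proof (rule recursive_comp1[of tri_root])
  have "recursive 1 (\<lambda>xs. LEAST w. Suc ((xs @ [w]) ! 0) - triangle (Suc ((xs @ [w]) ! 1)) = 0)"
  proof (rule recursive_Least[of 1 "\<lambda>xs. Suc (xs ! 0) - triangle (Suc (xs ! 1))"])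
    show "recursive (Suc 1) (\<lambda>xs. Suc (xs ! 0) - triangle (Suc (xs ! 1)))"
      by (intro recursive_diff recursive_triangle recursive_Suc recursive_arg) simp_all
    have le: "n \<le> triangle n" for n by (induction n) auto
    show "\<exists>w. Suc ((xs @ [w]) ! 0) - triangle (Suc ((xs @ [w]) ! 1)) = 0" if "length xs = 1" for xs
      using that le[of "Suc (xs ! 0)"] by (intro exI[of _ "xs ! 0"]) (auto simp: length_Suc_conv)
  qed
  then show "recursive 1 (\<lambda>xs. tri_root (xs ! 0))"
    unfolding tri_root_def by (rule recursive_cong) (auto simp: length_Suc_conv)
qed

lemma fst_prod_decode: "fst (prod_decode x) = x - triangle (tri_root x)"
  and snd_prod_decode: "snd (prod_decode x) = tri_root x - (x - triangle (tri_root x))"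
proof -
  obtain a b where "x = prod_encode (a, b)" by (metis prod_decode_inverse surj_pair)
  then show "fst (prod_decode x) = x - triangle (tri_root x)"
    and "snd (prod_decode x) = tri_root x - (x - triangle (tri_root x))"
    by (simp_all add: tri_root_prod_encode) (simp_all add: prod_encode_def)
qed

lemma recursive_fst_prod_decode: "recursive k A \<Longrightarrow> recursive k (\<lambda>xs. fst (prod_decode (A xs)))"
  unfolding fst_prod_decode by (intro recursive_diff recursive_triangle recursive_tri_root)

lemma recursive_snd_prod_decode: "recursive k A \<Longrightarrow> recursive k (\<lambda>xs. snd (prod_decode (A xs)))"
  unfolding snd_prod_decode by (intro recursive_diff recursive_triangle recursive_tri_root)

text \<open>\<open>Suc (prod_encode (y, l))\<close> codes the list with head \<open>y\<close> whose
  tail is coded by \<open>l\<close>. Entries are thus put in front of a list without decoding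
  it.\<close>

primrec loop :: "(nat \<Rightarrow> nat) \<Rightarrow> nat \<Rightarrow> nat \<Rightarrow> nat" where
  "loop e b 0 = b"
| "loop e b (Suc i) = Suc (prod_encode (e i, loop e b i))"

lemma loop_list_encode: "loop e (list_encode l) n = list_encode (map e (rev [0..<n]) @ l)"
  by (induction n) auto

lemma recursive_loop:
  assumes e: "recursive 2 (\<lambda>xs. e (xs ! 0) (xs ! 1))"
    and b: "recursive 1 (\<lambda>xs. b (xs ! 0))" and n: "recursive 1 (\<lambda>xs. n (xs ! 0))"
  shows "recursive 1 (\<lambda>xs. loop (e (xs ! 0)) (b (xs ! 0)) (n (xs ! 0)))"
proof -
  have eq: "loop (e x) (b x) m = rec_nat (b x) (\<lambda>i v. Suc (prod_encode (e x i, v))) m" for x m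
    by (induction m) auto
  show ?thesis
    unfolding eq
    by (rule recursive_rec_nat[of b "\<lambda>x i v. Suc (prod_encode (e x i, v))"])
      (auto intro!: b[simplified] n[simplified] recursive_Suc recursive_prod_encode recursive_arg recursive_comp2[of e, OF e])
qed

section \<open>The tiling game\<close>

text \<open>\<open>Top\<close> is the initial state and stands for column 0; the states \<open>Col x, \<dots>, Col 1\<close> stand for the
  columns \<open>1, \<dots>, x\<close> and \<open>Col 0\<close> for all later ones. In \<open>Row k\<close> both players count rows, where
  \<open>k \<noteq> 0\<close> is the type of the column in row 0. From \<open>HFirst\<close> on, player 2 is one column
  ahead of player 1; from \<open>AskV\<close> on, one row. \<open>ReplyV t\<close> and \<open>ReplyH t\<close> remember the answer of player 1
  while player 2 is being asked.\<close>

datatype gstate = Bad | Good | AskV | AskH | HWait | HFirst | Top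
  | Row nat | AskBoth nat | ReplyV nat | ReplyH nat | Col nat

datatype ob = W | W' | Ask | Done

fun obs :: "nat \<Rightarrow> gstate \<Rightarrow> ob" where
  "obs i Bad = Done"
| "obs i Good = Done"
| "obs i AskV = (if i = 1 then Ask else W')"
| "obs i AskH = (if i = 1 then Ask else W')"
| "obs i HWait = W'"
| "obs i HFirst = (if i = 1 then W' else W)"
| "obs i Top = W"
| "obs i (Row k) = W'"
| "obs i (AskBoth k) = Ask"
| "obs i (ReplyV t) = (if i = 1 then Done else Ask)"
| "obs i (ReplyH t) = (if i = 1 then Done else Ask)"
| "obs i (Col j) = W"

definition states :: "nat \<Rightarrow> nat \<Rightarrow> gstate set" where
  "states n x = {Bad, Good, AskV, AskH, HWait, HFirst, Top} \<union> Row ` {..<4} \<union> AskBoth ` {..<4}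
     \<union> ReplyV ` {..<n} \<union> ReplyH ` {..<n} \<union> Col ` {..x}"

text \<open>Move 0 of agent 3 prolongs the current phase, the other moves end it. Truncated
  subtraction makes \<open>Col 0\<close> its own successor, so it serves for all columns beyond
  \<open>x\<close>. Only the first state of a row phase can have \<open>k\<close> nonzero, so that
  the initial condition is tested in row 0 alone.\<close>

fun \<delta> :: "(nat \<Rightarrow> nat \<Rightarrow> bool) \<Rightarrow> (nat \<Rightarrow> nat \<Rightarrow> bool) \<Rightarrow> (nat \<Rightarrow> nat \<Rightarrow> bool) \<Rightarrow> nat
    \<Rightarrow> gstate \<Rightarrow> nat \<Rightarrow> nat \<Rightarrow> nat \<Rightarrow> gstate" where
  "\<delta> H V I x Bad a b e = Bad"
| "\<delta> H V I x Good a b e = Good"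
| "\<delta> H V I x AskV a b e = ReplyV a"
| "\<delta> H V I x AskH a b e = ReplyH a"
| "\<delta> H V I x HWait a b e = (if e = 0 then HWait else AskH)"
| "\<delta> H V I x HFirst a b e = (if e = 0 then HWait else AskH)"
| "\<delta> H V I x Top a b e = (if e = 0 then Col x else if e = 1 then Row 1 else HFirst)"
| "\<delta> H V I x (Row k) a b e = (if e = 0 then Row 0 else if e = 1 then AskBoth k else AskV)"
| "\<delta> H V I x (AskBoth k) a b e = (if a = b \<and> (k = 0 \<or> I k a) then Good else Bad)"
| "\<delta> H V I x (ReplyV t) a b e = (if V t b then Good else Bad)"
| "\<delta> H V I x (ReplyH t) a b e = (if H t b then Good else Bad)"
| "\<delta> H V I x (Col j) a b e =
    (if e = 0 then Col (j - 1) else if e = 1 then Row (if j = 0 then 3 else 2) else HFirst)"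

definition column :: "nat \<Rightarrow> nat \<Rightarrow> gstate" where
  "column x a = (if a = 0 then Top else Col (x + 1 - a))"

definition row_type :: "nat \<Rightarrow> nat \<Rightarrow> nat \<Rightarrow> nat" where
  "row_type x a b = (if b = 0 then col_type x a else 0)"

text \<open>A player that is not asked has the single action 0, so a chain state needs only three
  listed transitions.\<close>

definition moves :: "nat \<Rightarrow> nat \<Rightarrow> gstate \<Rightarrow> nat set" where
  "moves n i p = (if i = 3 then {..<3} else if obs i p = Ask then {..<n} else {0})"

text \<open>Histories are prefixes of infinite paths, so even a single state has to be continued
  forever; nonempty protocols permit this.\<close>

lemma FPath_single:
  assumes ne: "\<And>p i. \<lbrakk>p \<in> St G; i \<in> Ag G\<rbrakk> \<Longrightarrow> Prot G i p \<noteq> {}"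
    and cl: "\<And>p a. \<lbrakk>p \<in> St G; \<forall>i\<in>Ag G. a i \<in> Prot G i p\<rbrakk> \<Longrightarrow> Delta G p a \<in> St G"
    and p: "p \<in> St G"
  shows "[p] \<in> FPath G"
proof -
  define d where "d q i = (SOME a. a \<in> Prot G i q)" for q i
  have d: "\<forall>i\<in>Ag G. d q i \<in> Prot G i q" if "q \<in> St G" for q
    using ne[OF that] unfolding d_def by (simp add: some_in_eq)
  define r where "r j = ((\<lambda>q. Delta G q (d q)) ^^ j) p" for j
  have r: "r j \<in> St G" for j
  proof (induction j)
    case (Suc j)
    from cl[OF this d[OF this]] show ?case by (simp add: r_def)
  qed (simp add: r_def p)
  have "is_path G r"
    unfolding is_path_def using d[OF r] r[of 0] by (auto simp: r_def)
  then show ?thesis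
    unfolding FPath_def by (auto intro!: exI[of _ r] exI[of _ 0] simp: r_def)
qed

lemma path_states:
  assumes cl: "\<And>p a. \<lbrakk>p \<in> St G; \<forall>i\<in>Ag G. a i \<in> Prot G i p\<rbrakk> \<Longrightarrow> Delta G p a \<in> St G"
    and r: "is_path G r"
  shows "r j \<in> St G"
proof (induction j)
  case (Suc j)
  obtain a where "\<forall>i\<in>Ag G. a i \<in> Prot G i (r j)" "r (Suc j) = Delta G (r j) a"
    using r unfolding is_path_def by blast
  then show ?case using cl[OF Suc] by simp
qed (use r in \<open>simp add: is_path_def\<close>)

lemma FPath_snoc:
  assumes ne: "\<And>p i. \<lbrakk>p \<in> St G; i \<in> Ag G\<rbrakk> \<Longrightarrow> Prot G i p \<noteq> {}"
    and cl: "\<And>p a. \<lbrakk>p \<in> St G; \<forall>i\<in>Ag G. a i \<in> Prot G i p\<rbrakk> \<Longrightarrow> Delta G p a \<in> St G"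
    and h: "h \<in> FPath G" and a: "\<forall>i\<in>Ag G. a i \<in> Prot G i (last h)"
  shows "h @ [Delta G (last h) a] \<in> FPath G"
proof -
  obtain r n where r: "is_path G r" and hr: "h = map r [0..<Suc n]"
    using h unfolding FPath_def by blast
  have last: "last h = r n" by (simp add: hr)
  have rS: "r j \<in> St G" for j by (rule path_states[OF cl r])
  have dS: "Delta G (r n) a \<in> St G" by (rule cl[OF rS]) (use a last in simp)
  have "[Delta G (r n) a] \<in> FPath G" by (rule FPath_single[OF ne cl dS])
  then obtain r' m where r': "is_path G r'" and m: "[Delta G (r n) a] = map r' [0..<Suc m]"
    unfolding FPath_def mem_Collect_eq by (elim exE conjE) (rule that)
  then have r'0: "r' 0 = Delta G (r n) a" by (simp add: upt_conv_Cons del: upt_Suc)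
  define q where "q j = (if j \<le> n then r j else r' (j - Suc n))" for j
  have "is_path G q"
    unfolding is_path_def
  proof (intro conjI allI)
    show "q 0 \<in> St G" using rS by (simp add: q_def)
    fix j
    consider "j < n" | "j = n" | "j > n" by linarith
    then show "\<exists>a. (\<forall>i\<in>Ag G. a i \<in> Prot G i (q j)) \<and> q (Suc j) = Delta G (q j) a"
    proof cases
      case 1
      then show ?thesis using r unfolding is_path_def q_def by simp
    next
      case 2
      then show ?thesis using a r'0 by (auto simp: q_def last)
    next
      case 3
      then have "Suc j - Suc n = Suc (j - Suc n)" by simp
      then show ?thesis using 3 r' unfolding is_path_def q_def by simp
    qed
  qed
  moreover have "h @ [Delta G (last h) a] = map q [0..<Suc (Suc n)]"
    unfolding hr by (simp add: q_def r'0)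
  ultimately show ?thesis unfolding FPath_def by blast
qed

lemma FPath_states:
  assumes cl: "\<And>p a. \<lbrakk>p \<in> St G; \<forall>i\<in>Ag G. a i \<in> Prot G i p\<rbrakk> \<Longrightarrow> Delta G p a \<in> St G"
    and "h \<in> FPath G"
  shows "h \<noteq> []" "set h \<subseteq> St G"
proof -
  obtain r n where r: "is_path G r" and hr: "h = map r [0..<Suc n]"
    using assms(2) unfolding FPath_def by blast
  have "r j \<in> St G" for j by (rule path_states[OF cl r])
  then show "h \<noteq> []" "set h \<subseteq> St G" unfolding hr by auto
qed

lemma length_hist: "length (hist G \<sigma> p j) = Suc j"
  by (induction j) (simp_all add: Let_def)

text \<open>Allows the moves of agent 3 to be changed at later times without disturbing the history
  up to now.\<close>

lemma hist_cong:
  "(\<And>i h. length h \<le> j \<Longrightarrow> \<sigma> i h = \<tau> i h) \<Longrightarrow> hist G \<sigma> p j = hist G \<tau> p j"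
  by (induction j) (simp_all add: Let_def length_hist)

text \<open>Separates the game argument from the list encoding. \<open>Delta\<close> is prescribed
  only for actions allowed by the protocol, since plays use no others.\<close>

locale board =
  fixes n :: nat and H V I :: "nat \<Rightarrow> nat \<Rightarrow> bool" and x ok :: nat
    and G :: "(nat, nat, nat) cgs" and num :: "gstate \<Rightarrow> nat"
  assumes n_pos: "0 < n"
    and inj: "inj_on num (states n x)"
    and St: "St G = num ` states n x"
    and Ag: "Ag G = {1, 2, 3}"
    and Ind: "\<lbrakk>i \<in> {1, 2}; p \<in> states n x; q \<in> states n x\<rbrakk> \<Longrightarrow> (num p, num q) \<in> Ind G i \<longleftrightarrow> obs i p = obs i q"
    and Prot: "\<lbrakk>i \<in> {1, 2, 3}; p \<in> states n x\<rbrakk> \<Longrightarrow> Prot G i (num p) = moves n i p"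
    and Delta: "\<lbrakk>p \<in> states n x; \<And>i. i \<in> {1, 2, 3} \<Longrightarrow> a i \<in> moves n i p\<rbrakk>
      \<Longrightarrow> Delta G (num p) a = num (\<delta> H V I x p (a 1) (a 2) (a 3))"
    and Lab: "p \<in> states n x \<Longrightarrow> ok \<in> Lab G (num p) \<longleftrightarrow> p \<noteq> Bad"
begin

abbreviation "S \<equiv> states n x"
abbreviation "\<Delta> \<equiv> \<delta> H V I x"

lemma \<delta>_states:
  assumes "p \<in> S" "a \<in> moves n 1 p" "b \<in> moves n 2 p"
  shows "\<Delta> p a b e \<in> S"
  using assms by (cases p) (auto simp: states_def moves_def)

lemma Delta_closed: "\<lbrakk>p \<in> St G; \<forall>i\<in>Ag G. a i \<in> Prot G i p\<rbrakk> \<Longrightarrow> Delta G p a \<in> St G"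
proof -
  assume "p \<in> St G" and a: "\<forall>i\<in>Ag G. a i \<in> Prot G i p"
  then obtain q where q: "p = num q" "q \<in> S" by (auto simp: St)
  then have m: "a i \<in> moves n i q" if "i \<in> {1, 2, 3}" for i using that a by (auto simp: Ag Prot)
  have "Delta G (num q) a = num (\<Delta> q (a 1) (a 2) (a 3))" by (rule Delta[OF q(2) m])
  moreover have "\<Delta> q (a 1) (a 2) (a 3) \<in> S" by (rule \<delta>_states[OF q(2) m m]) simp_all
  ultimately show "Delta G p a \<in> St G" unfolding q(1) St by simp
qed

lemma Prot_nonempty: "\<lbrakk>p \<in> St G; i \<in> Ag G\<rbrakk> \<Longrightarrow> Prot G i p \<noteq> {}"
  using n_pos by (auto simp: St Ag Prot moves_def lessThan_empty_iff split: if_splits)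

lemma FPath_singleton: "p \<in> St G \<Longrightarrow> [p] \<in> FPath G"
  by (rule FPath_single[OF Prot_nonempty Delta_closed])

lemma FPath_append:
  "\<lbrakk>h \<in> FPath G; \<forall>i\<in>Ag G. a i \<in> Prot G i (last h)\<rbrakk> \<Longrightarrow> h @ [Delta G (last h) a] \<in> FPath G"
  by (rule FPath_snoc[OF Prot_nonempty Delta_closed])

text \<open>Strategies of agent 3 are replaced by a free choice of the move \<open>e\<close> at each
  step.\<close>

inductive reach :: "(nat list \<Rightarrow> nat) \<Rightarrow> (nat list \<Rightarrow> nat) \<Rightarrow> gstate list \<Rightarrow> bool" for f g where
  reach_start: "reach f g [Top]"
| reach_step: "\<lbrakk>reach f g h; e < 3\<rbrakk>
    \<Longrightarrow> reach f g (h @ [\<Delta> (last h) (f (map num h)) (g (map num h)) e])"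

lemma strat_moves:
  assumes "IR_strat G i f" "i \<in> {1, 2, 3}" "map num h \<in> FPath G" "h \<noteq> []" "last h \<in> S"
  shows "f (map num h) \<in> moves n i (last h)"
proof -
  have "f (map num h) \<in> Prot G i (last (map num h))" using assms by (simp add: IR_strat_def)
  then show ?thesis using assms Prot by (simp add: last_map)
qed

lemma iR_strat_IR: "iR_strat G i f \<Longrightarrow> IR_strat G i f"
  by (simp add: iR_strat_def)

lemma profile_moves:
  assumes "iR_strat G 1 f" "iR_strat G 2 g" "map num h \<in> FPath G" "h \<noteq> []" "last h \<in> S"
    and "a 1 = f (map num h)" "a 2 = g (map num h)" "a 3 < 3" and i: "i \<in> {1, 2, 3}"
  shows "a i \<in> moves n i (last h)"
proof -
  have "a 3 \<in> moves n 3 (last h)" using assms by (simp add: moves_def)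
  moreover have "a 1 \<in> moves n 1 (last h)"
    unfolding assms(6) by (rule strat_moves[OF iR_strat_IR]) (use assms in simp_all)
  moreover have "a 2 \<in> moves n 2 (last h)"
    unfolding assms(7) by (rule strat_moves[OF iR_strat_IR]) (use assms in simp_all)
  ultimately show ?thesis using i by blast
qed

lemma reach_FPath:
  assumes f: "iR_strat G 1 f" and g: "iR_strat G 2 g" and "reach f g h"
  shows "map num h \<in> FPath G \<and> h \<noteq> [] \<and> set h \<subseteq> S \<and> last h \<in> S"
  using assms(3)
proof induction
  case reach_start
  have "num Top \<in> St G" by (simp add: St states_def)
  then show ?case using FPath_singleton by (simp add: states_def)
next
  case (reach_step h e)
  then have h: "map num h \<in> FPath G" "h \<noteq> []" "last h \<in> S" "set h \<subseteq> S" by auto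
  define a where "a = (\<lambda>i. if i = (1::nat) then f (map num h) else if i = 2 then g (map num h) else e)"
  have a: "a i \<in> moves n i (last h)" if "i \<in> {1, 2, 3}" for i
    by (rule profile_moves[OF f g h(1,2,3) _ _ _ that]) (use reach_step(2) in \<open>simp_all add: a_def\<close>)
  have "map num h @ [Delta G (last (map num h)) a] \<in> FPath G"
    by (rule FPath_append[OF h(1)]) (use a h in \<open>simp add: Ag last_map Prot\<close>)
  moreover have "Delta G (last (map num h)) a = num (\<Delta> (last h) (f (map num h)) (g (map num h)) e)"
    using Delta[OF h(3) a] h(2) by (simp add: last_map a_def)
  moreover have "\<Delta> (last h) (f (map num h)) (g (map num h)) e \<in> S"
    using \<delta>_states[OF h(3), of "a 1" "a 2" e] a[of 1] a[of 2] by (simp add: a_def)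
  ultimately show ?case using h by simp
qed

lemma reach_Delta:
  assumes f: "iR_strat G 1 f" and g: "iR_strat G 2 g" and h: "reach f g h"
    and a: "a 1 = f (map num h)" "a 2 = g (map num h)" "a 3 < 3"
  shows "Delta G (last (map num h)) a = num (\<Delta> (last h) (f (map num h)) (g (map num h)) (a 3))"
proof -
  from reach_FPath[OF f g h] have h': "map num h \<in> FPath G" "h \<noteq> []" "last h \<in> S" by auto
  have "a i \<in> moves n i (last h)" if "i \<in> {1, 2, 3}" for i
    by (rule profile_moves[OF f g h' a that])
  from Delta[OF h'(3) this] show ?thesis using h'(2) a by (simp add: last_map)
qed

text \<open>Agent 3 observes everything, so its choices along one history are unrestricted: a
  reachable history is realised by a strategy that looks only at the length of its argument.
  Conversely, any strategy of agent 3 plays legal moves and produces reachable histories.\<close>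

lemma sat_iff:
  assumes \<pi>: "\<pi> 1 = iR" "\<pi> 2 = iR" "\<pi> 3 = IR"
  shows "sat_AG G \<pi> {1, 2} ok (num Top) \<longleftrightarrow>
    (\<exists>f g. iR_strat G 1 f \<and> iR_strat G 2 g \<and> (\<forall>h. reach f g h \<longrightarrow> last h \<noteq> Bad))"
    (is "?L \<longleftrightarrow> ?R")
proof
  assume ?L
  then obtain \<sigma> where \<sigma>: "\<And>i. i \<in> {1, 2} \<Longrightarrow> \<sigma> i \<in> strats G \<pi> i"
    and win: "\<And>\<tau> j. (\<And>i. i \<in> Ag G - {1, 2} \<Longrightarrow> \<tau> i \<in> strats G \<pi> i) \<Longrightarrow>
      ok \<in> Lab G (play G (\<lambda>i. if i \<in> {1, 2} then \<sigma> i else \<tau> i) (num Top) j)"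
    unfolding sat_AG_def by blast
  have f: "iR_strat G 1 (\<sigma> 1)" and g: "iR_strat G 2 (\<sigma> 2)"
    using \<sigma>[of 1] \<sigma>[of 2] \<pi> by (simp_all add: strats_def)
  let ?\<sigma> = "\<lambda>ev i. if i \<in> {1, 2} then \<sigma> i else (\<lambda>h :: nat list. ev (length h) :: nat)"
  have env: "\<exists>ev. (\<forall>j. ev j < 3) \<and> hist G (?\<sigma> ev) (num Top) (length h - 1) = map num h"
    if "reach (\<sigma> 1) (\<sigma> 2) h" for h
    using that
  proof induction
    case reach_start
    show ?case by (intro exI[of _ "\<lambda>_. 0"]) simp
  next
    case (reach_step h e)
    then obtain ev where ev: "\<forall>j. ev j < 3" "hist G (?\<sigma> ev) (num Top) (length h - 1) = map num h"
      by blast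
    \<comment> \<open>Only the decision taken at the end of \<open>h\<close> is overwritten; shorter
      histories do not depend on it.\<close>
    let ?ev = "ev(length h := e)"
    have l: "length h = Suc (length h - 1)" using reach_FPath[OF f g reach_step(1)] by simp
    have "hist G (?\<sigma> ?ev) (num Top) (length h - 1) = map num h"
      unfolding ev(2)[symmetric] by (rule hist_cong) (use l in auto)
    then have "hist G (?\<sigma> ?ev) (num Top) (length h) =
        map num h @ [Delta G (last (map num h)) (\<lambda>i. ?\<sigma> ?ev i (map num h))]"
      by (subst l) (simp add: Let_def)
    moreover have "Delta G (last (map num h)) (\<lambda>i. ?\<sigma> ?ev i (map num h)) =
        num (\<Delta> (last h) (\<sigma> 1 (map num h)) (\<sigma> 2 (map num h)) e)"
      by (subst reach_Delta[OF f g reach_step(1)]) (simp_all add: reach_step(2))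
    ultimately show ?case
      using ev(1) reach_step(2) by (intro exI[of _ ?ev]) simp
  qed
  have "last h \<noteq> Bad" if h: "reach (\<sigma> 1) (\<sigma> 2) h" for h
  proof -
    obtain ev where ev: "\<forall>j. ev j < 3" "hist G (?\<sigma> ev) (num Top) (length h - 1) = map num h"
      using env[OF h] by blast
    have "(\<lambda>h. ev (length h)) \<in> strats G \<pi> i" if i: "i \<in> Ag G - {1, 2}" for i
    proof -
      have "ev (length h) \<in> Prot G 3 (last h)" if "h \<in> FPath G" for h
      proof -
        have "last h \<in> St G" using FPath_states[OF Delta_closed that] by auto
        then show ?thesis using ev(1) by (auto simp: St Prot moves_def)
      qed
      then show ?thesis using i \<pi> by (auto simp: Ag strats_def IR_strat_def)
    qed
    from win[OF this, of "length h - 1"] have "ok \<in> Lab G (last (map num h))"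
      unfolding play_def ev(2) by simp
    then show ?thesis using reach_FPath[OF f g h] Lab[of "last h"] by (auto simp: last_map)
  qed
  then show ?R using f g by blast
next
  assume ?R
  then obtain f g where f: "iR_strat G 1 f" and g: "iR_strat G 2 g"
    and ok: "\<And>h. reach f g h \<Longrightarrow> last h \<noteq> Bad" by blast
  let ?\<sigma> = "\<lambda>i::nat. if i = 1 then f else g"
  show ?L
    unfolding sat_AG_def
  proof (intro exI[of _ ?\<sigma>] conjI ballI allI impI)
    fix i :: nat assume "i \<in> {1, 2}"
    then show "?\<sigma> i \<in> strats G \<pi> i" using f g \<pi> by (auto simp: strats_def)
  next
    fix \<tau> j assume "\<forall>i\<in>Ag G - {1, 2}. \<tau> i \<in> strats G \<pi> i"
    then have \<tau>: "IR_strat G 3 (\<tau> 3)" using \<pi> by (simp add: Ag strats_def)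
    let ?\<rho> = "\<lambda>i. if i \<in> {1, 2} then ?\<sigma> i else \<tau> i"
    have "\<exists>h. reach f g h \<and> hist G ?\<rho> (num Top) j = map num h"
    proof (induction j)
      case 0
      show ?case using reach_start[of f g] by force
    next
      case (Suc j)
      then obtain h where h: "reach f g h" "hist G ?\<rho> (num Top) j = map num h" by blast
      note hF = reach_FPath[OF f g h(1)]
      have e: "\<tau> 3 (map num h) < 3"
        using strat_moves[OF \<tau>, of h] hF by (simp add: moves_def)
      have "hist G ?\<rho> (num Top) (Suc j) =
          map num h @ [Delta G (last (map num h)) (\<lambda>i. ?\<rho> i (map num h))]"
        by (simp only: hist.simps h(2) Let_def)
      also have "Delta G (last (map num h)) (\<lambda>i. ?\<rho> i (map num h)) =
          num (\<Delta> (last h) (f (map num h)) (g (map num h)) (\<tau> 3 (map num h)))"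
        by (subst reach_Delta[OF f g h(1)]) (simp_all add: e)
      finally show ?case using reach_step[OF h(1) e] by force
    qed
    then obtain h where h: "reach f g h" "hist G ?\<rho> (num Top) j = map num h" by blast
    then have "ok \<in> Lab G (last (map num h))"
      using reach_FPath[OF f g h(1)] ok[OF h(1)] Lab[of "last h"] by (auto simp: last_map)
    then show "ok \<in> Lab G (play G ?\<rho> (num Top) j)" unfolding play_def h(2) .
  qed
qed

end

section \<open>Winning strategies and tilings\<close>

context board
begin

definition hCol :: "nat \<Rightarrow> gstate list" where
  "hCol a = map (column x) [0..<Suc a]"

definition hRow :: "nat \<Rightarrow> nat \<Rightarrow> gstate list" where
  "hRow a b = hCol a @ Row (col_type x a) # replicate b (Row 0)"

definition hAskBoth :: "nat \<Rightarrow> nat \<Rightarrow> gstate list" where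
  "hAskBoth a b = hRow a b @ [AskBoth (row_type x a b)]"

definition hAskV :: "nat \<Rightarrow> nat \<Rightarrow> gstate list" where
  "hAskV a b = hRow a b @ [AskV]"

definition hAskH :: "nat \<Rightarrow> nat \<Rightarrow> gstate list" where
  "hAskH a b = hCol a @ HFirst # replicate b HWait @ [AskH]"

text \<open>What a player sees up to the moment when it is asked for the tile at \<open>(a, b)\<close>.\<close>

definition signal :: "nat \<Rightarrow> nat \<Rightarrow> ob list" where
  "signal a b = replicate (Suc a) W @ replicate (Suc b) W' @ [Ask]"

lemma obs_column: "obs i (column x a) = W"
  by (simp add: column_def)

lemma obs_hCol: "map (obs i) (hCol a) = replicate (Suc a) W"
  unfolding hCol_def map_map o_def obs_column by (simp add: map_replicate_const del: upt_Suc)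

text \<open>Equal signals carry answers over from one test to another. Player 1 cannot tell the
  three tests apart, and the delayed player 2 takes its question for a joint one at the upper or
  right neighbour.\<close>

lemma obs_histories:
  "map (obs i) (hAskBoth a b) = signal a b"
  "map (obs 1) (hAskV a b) = signal a b"
  "map (obs 1) (hAskH a b) = signal a b"
  "map (obs 2) (hAskV a b @ [ReplyV t]) = signal a (Suc b)"
  "map (obs 2) (hAskH a b @ [ReplyH t]) = signal (Suc a) b"
  unfolding hAskBoth_def hAskV_def hAskH_def hRow_def signal_def map_append obs_hCol
  by (simp_all flip: replicate_append_same)

lemma last_hCol: "last (hCol a) = column x a"
  by (simp add: hCol_def)

lemma last_hRow: "last (hRow a b) = Row (row_type x a b)"
  by (cases b) (simp_all add: hRow_def row_type_def)

lemma reach_to: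
  assumes "reach f g h" "\<Delta> (last h) (f (map num h)) (g (map num h)) e = q" "e < 3"
  shows "reach f g (h @ [q])"
  using reach_step[OF assms(1,3)] assms(2) by simp

lemma reach_hCol: "reach f g (hCol a)"
proof (induction a)
  case 0
  show ?case using reach_start by (simp add: hCol_def column_def)
next
  case (Suc a)
  have "hCol (Suc a) = hCol a @ [column x (Suc a)]" by (simp add: hCol_def)
  moreover have "reach f g (hCol a @ [column x (Suc a)])"
    by (rule reach_to[OF Suc, where e = 0]) (auto simp: last_hCol column_def)
  ultimately show ?case by simp
qed

lemma reach_hRow: "reach f g (hRow a b)"
proof (induction b)
  case 0
  have "reach f g (hCol a @ [Row (col_type x a)])"
    by (rule reach_to[OF reach_hCol, where e = 1]) (auto simp: last_hCol column_def col_type_def)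
  then show ?case by (simp add: hRow_def)
next
  case (Suc b)
  have "reach f g (hRow a b @ [Row 0])"
    by (rule reach_to[OF Suc, where e = 0]) (auto simp: last_hRow)
  then show ?case by (simp add: hRow_def flip: replicate_append_same)
qed

lemma reach_hAskBoth: "reach f g (hAskBoth a b)"
  unfolding hAskBoth_def by (rule reach_to[OF reach_hRow, where e = 1]) (auto simp: last_hRow)

lemma reach_hAskV: "reach f g (hAskV a b)"
  unfolding hAskV_def by (rule reach_to[OF reach_hRow, where e = 2]) (auto simp: last_hRow)

lemma reach_hAskH: "reach f g (hAskH a b)"
proof -
  have 1: "reach f g (hCol a @ [HFirst])"
    by (rule reach_to[OF reach_hCol, where e = 2]) (auto simp: last_hCol column_def)
  have l: "last (hCol a @ HFirst # replicate b HWait) \<in> {HFirst, HWait}" for b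
    by (cases b) auto
  have "reach f g (hCol a @ HFirst # replicate b HWait)"
  proof (induction b)
    case 0
    then show ?case using 1 by simp
  next
    case (Suc b)
    have "reach f g ((hCol a @ HFirst # replicate b HWait) @ [HWait])"
      by (rule reach_to[OF Suc, where e = 0]) (use l[of b] in auto)
    then show ?case by (simp flip: replicate_append_same)
  qed
  then have "reach f g ((hCol a @ HFirst # replicate b HWait) @ [AskH])"
    by (rule reach_to[where e = 1]) (use l[of b] in auto)
  then show ?thesis by (simp add: hAskH_def)
qed

lemma strat_obs_cong:
  assumes i: "i \<in> {1, 2}" and k: "iR_strat G i k"
    and f: "iR_strat G 1 f" and g: "iR_strat G 2 g" and h: "reach f g h" "reach f g h'"
    and eq: "map (obs i) h = map (obs i) h'"
  shows "k (map num h) = k (map num h')"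
proof -
  note h1 = reach_FPath[OF f g h(1)] and h2 = reach_FPath[OF f g h(2)]
  have l: "length h = length h'" using eq by (rule map_eq_imp_length_eq)
  have "(num (h ! j), num (h' ! j)) \<in> Ind G i" if "j < length h" for j
  proof -
    have "h ! j \<in> S" "h' ! j \<in> S" using that l h1 h2 by auto
    moreover have "obs i (h ! j) = obs i (h' ! j)" using eq that l by (metis nth_map)
    ultimately show ?thesis using Ind[OF i] by simp
  qed
  then have "indist G i (map num h) (map num h')" unfolding indist_def by (simp add: l)
  then show ?thesis using k h1 h2 unfolding iR_strat_def by blast
qed

text \<open>The joint tests make both players use the same function \<open>t\<close>. In the delayed
  tests, uniformity forces player 1 to answer by \<open>t\<close> at the position itself and player
  2 by \<open>t\<close> at the neighbour, so surviving the test gives \<open>V\<close> or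
  \<open>H\<close>.\<close>

lemma winning_imp_tiles:
  assumes f: "iR_strat G 1 f" and g: "iR_strat G 2 g"
    and win: "\<And>h. reach f g h \<Longrightarrow> last h \<noteq> Bad"
  shows "tiles {..<n} H V I x (\<lambda>a b. f (map num (hAskBoth a b)))"
proof -
  define t where "t a b = f (map num (hAskBoth a b))" for a b
  note f_cong = strat_obs_cong[OF _ f f g] and g_cong = strat_obs_cong[OF _ g f g]
  have both: "g (map num (hAskBoth a b)) = t a b \<and> (row_type x a b = 0 \<or> I (row_type x a b) (t a b))" for a b
  proof -
    have "last (hAskBoth a b @ [\<Delta> (last (hAskBoth a b)) (t a b) (g (map num (hAskBoth a b))) 0]) \<noteq> Bad"
      unfolding t_def by (rule win[OF reach_step[OF reach_hAskBoth]]) simp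
    then show ?thesis by (auto simp: hAskBoth_def split: if_splits)
  qed
  have "t a b < n" for a b
  proof -
    have "f (map num (hAskBoth a b)) \<in> moves n 1 (last (hAskBoth a b))"
      by (rule strat_moves[OF iR_strat_IR[OF f]]) (use reach_FPath[OF f g reach_hAskBoth] in auto)
    then show ?thesis by (simp add: moves_def hAskBoth_def t_def)
  qed
  moreover have "V (t a b) (t a (Suc b))" for a b
  proof -
    have r: "reach f g (hAskV a b @ [ReplyV (t a b)])"
    proof (rule reach_to[OF reach_hAskV, where e = 0])
      have "f (map num (hAskV a b)) = t a b"
        unfolding t_def by (rule f_cong[OF _ reach_hAskV reach_hAskBoth]) (simp_all only: obs_histories, simp)
      then show "\<Delta> (last (hAskV a b)) (f (map num (hAskV a b))) (g (map num (hAskV a b))) 0 = ReplyV (t a b)"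
        by (simp add: hAskV_def)
    qed simp
    have "g (map num (hAskV a b @ [ReplyV (t a b)])) = g (map num (hAskBoth a (Suc b)))"
      by (rule g_cong[OF _ r reach_hAskBoth]) (simp_all only: obs_histories, simp)
    then have e: "g (map num (hAskV a b @ [ReplyV (t a b)])) = t a (Suc b)" using both by simp
    have "\<Delta> (ReplyV (t a b)) (f (map num (hAskV a b @ [ReplyV (t a b)]))) (t a (Suc b)) 0 \<noteq> Bad"
      using win[OF reach_step[OF r, of 0]] unfolding e by simp
    then show ?thesis by (auto split: if_splits)
  qed
  moreover have "H (t a b) (t (Suc a) b)" for a b
  proof -
    have r: "reach f g (hAskH a b @ [ReplyH (t a b)])"
    proof (rule reach_to[OF reach_hAskH, where e = 0])
      have "f (map num (hAskH a b)) = t a b"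
        unfolding t_def by (rule f_cong[OF _ reach_hAskH reach_hAskBoth]) (simp_all only: obs_histories, simp)
      then show "\<Delta> (last (hAskH a b)) (f (map num (hAskH a b))) (g (map num (hAskH a b))) 0 = ReplyH (t a b)"
        by (simp add: hAskH_def)
    qed simp
    have "g (map num (hAskH a b @ [ReplyH (t a b)])) = g (map num (hAskBoth (Suc a) b))"
      by (rule g_cong[OF _ r reach_hAskBoth]) (simp_all only: obs_histories, simp)
    then have e: "g (map num (hAskH a b @ [ReplyH (t a b)])) = t (Suc a) b" using both by simp
    have "\<Delta> (ReplyH (t a b)) (f (map num (hAskH a b @ [ReplyH (t a b)]))) (t (Suc a) b) 0 \<noteq> Bad"
      using win[OF reach_step[OF r, of 0]] unfolding e by simp
    then show ?thesis by (auto split: if_splits)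
  qed
  moreover have "I (col_type x a) (t a 0)" for a
    using both[of a 0] by (auto simp: row_type_def col_type_def split: if_splits)
  ultimately have "tiles {..<n} H V I x t" unfolding tiles_def by simp
  then show ?thesis unfolding t_def .
qed

text \<open>The invariant of the plays in which both players answer \<open>t a b\<close> when asked after
  \<open>a + 1\<close> observations \<open>W\<close> and \<open>b + 1\<close> observations \<open>W'\<close>; \<open>wi\<close> and \<open>vi\<close> count the two
  observations made so far by player \<open>i\<close>.\<close>

fun consistent :: "(nat \<Rightarrow> nat \<Rightarrow> nat) \<Rightarrow> gstate \<Rightarrow> nat \<Rightarrow> nat \<Rightarrow> nat \<Rightarrow> nat \<Rightarrow> bool" where
  "consistent t Good w1 v1 w2 v2 \<longleftrightarrow> True"
| "consistent t Bad w1 v1 w2 v2 \<longleftrightarrow> False"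
| "consistent t Top w1 v1 w2 v2 \<longleftrightarrow> w1 = 1 \<and> v1 = 0 \<and> w2 = 1 \<and> v2 = 0"
| "consistent t (Col j) w1 v1 w2 v2 \<longleftrightarrow>
     w1 = w2 \<and> 2 \<le> w1 \<and> v1 = 0 \<and> v2 = 0 \<and> j = x + 2 - w1"
| "consistent t (Row k) w1 v1 w2 v2 \<longleftrightarrow>
     w1 = w2 \<and> v1 = v2 \<and> 0 < w1 \<and> 0 < v1 \<and> k = row_type x (w1 - 1) (v1 - 1)"
| "consistent t (AskBoth k) w1 v1 w2 v2 \<longleftrightarrow>
     w1 = w2 \<and> v1 = v2 \<and> 0 < w1 \<and> 0 < v1 \<and> k = row_type x (w1 - 1) (v1 - 1)"
| "consistent t AskV w1 v1 w2 v2 \<longleftrightarrow> w1 = w2 \<and> v2 = Suc v1 \<and> 0 < w1 \<and> 0 < v1"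
| "consistent t (ReplyV u) w1 v1 w2 v2 \<longleftrightarrow>
     w1 = w2 \<and> v2 = Suc v1 \<and> 0 < w1 \<and> 0 < v1 \<and> u = t (w1 - 1) (v1 - 1)"
| "consistent t HFirst w1 v1 w2 v2 \<longleftrightarrow> w2 = Suc w1 \<and> 0 < w1 \<and> v1 = 1 \<and> v2 = 0"
| "consistent t HWait w1 v1 w2 v2 \<longleftrightarrow> w2 = Suc w1 \<and> 0 < w1 \<and> v1 = Suc v2 \<and> 0 < v2"
| "consistent t AskH w1 v1 w2 v2 \<longleftrightarrow> w2 = Suc w1 \<and> 0 < w1 \<and> v1 = v2 \<and> 0 < v1"
| "consistent t (ReplyH u) w1 v1 w2 v2 \<longleftrightarrow>
     w2 = Suc w1 \<and> 0 < w1 \<and> v1 = v2 \<and> 0 < v1 \<and> u = t (w1 - 1) (v1 - 1)"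

text \<open>The counts of the two players agree on the way to a joint test. At a reply, those of
  player 2 are ahead by exactly one row or one column, so the tested pair is an instance of
  \<open>V\<close> or \<open>H\<close>.\<close>

lemma consistent_step:
  assumes t: "tiles {..<n} H V I x t" and c: "consistent t p w1 v1 w2 v2" and "e < 3"
    and a: "a = (if obs 1 p = Ask then t (w1 - 1) (v1 - 1) else 0)"
    and b: "b = (if obs 2 p = Ask then t (w2 - 1) (v2 - 1) else 0)"
    and q: "q = \<Delta> p a b e"
  shows "consistent t q (w1 + of_bool (obs 1 q = W)) (v1 + of_bool (obs 1 q = W'))
    (w2 + of_bool (obs 2 q = W)) (v2 + of_bool (obs 2 q = W'))"
proof -
  have H: "H (t a b) (t (Suc a) b)" and V: "V (t a b) (t a (Suc b))" and I: "I (col_type x a) (t a 0)" for a b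
    using t unfolding tiles_def by blast+
  show ?thesis
  proof (cases p)
    case Top
    then show ?thesis using c unfolding q by (auto simp: row_type_def col_type_def)
  next
    case (Col j)
    then show ?thesis using c unfolding q by (auto simp: row_type_def col_type_def)
  next
    case (Row k)
    then show ?thesis using c unfolding q by (auto simp: row_type_def)
  next
    case (AskBoth k)
    have "k = 0 \<or> I k (t (w1 - 1) (v1 - 1))"
      using AskBoth c I[of "w1 - 1"] by (auto simp: row_type_def)
    then show ?thesis using AskBoth c unfolding q a b by auto
  next
    case (ReplyV u)
    then show ?thesis using c V[of "w1 - 1" "v1 - 1"] unfolding q b by auto
  next
    case (ReplyH u)
    then show ?thesis using c H[of "w1 - 1" "v1 - 1"] unfolding q b by auto
  qed (use c in \<open>auto simp: q a\<close>)
qed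

text \<open>Subtracting 1 undoes the extra step of each phase. The default 0 is the only legal
  action of a player that is not asked.\<close>

definition answer :: "(nat \<Rightarrow> nat \<Rightarrow> nat) \<Rightarrow> ob list \<Rightarrow> nat" where
  "answer t w = (if last w = Ask then t (count_list w W - 1) (count_list w W' - 1) else 0)"

definition strat_of :: "(nat \<Rightarrow> nat \<Rightarrow> nat) \<Rightarrow> nat \<Rightarrow> nat list \<Rightarrow> nat" where
  "strat_of t i h = answer t (map (\<lambda>v. obs i (inv_into S num v)) h)"

lemma strat_of_num: "set h \<subseteq> S \<Longrightarrow> strat_of t i (map num h) = answer t (map (obs i) h)"
  unfolding strat_of_def map_map
  by (rule arg_cong[of _ _ "answer t"]) (auto simp: inv_into_f_f[OF inj])

lemma FPath_num: "h \<in> FPath G \<Longrightarrow> \<exists>h'. h = map num h' \<and> h' \<noteq> [] \<and> set h' \<subseteq> S"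
proof -
  assume h: "h \<in> FPath G"
  have "h \<noteq> []" "set h \<subseteq> St G" using FPath_states[OF Delta_closed h] by auto
  then show ?thesis
    by (intro exI[of _ "map (inv_into S num) h"])
      (auto simp: St map_idI f_inv_into_f subset_iff inv_into_into intro!: map_idI[symmetric])
qed

lemma iR_strat_of:
  assumes t: "\<And>a b. t a b < n" and i: "i \<in> {1, 2}"
  shows "iR_strat G i (strat_of t i)"
  unfolding iR_strat_def IR_strat_def
proof (intro conjI ballI impI)
  fix h assume "h \<in> FPath G"
  then obtain h' where h: "h = map num h'" "h' \<noteq> []" "set h' \<subseteq> S" using FPath_num by blast
  then have l: "last h' \<in> S" by auto
  have "Prot G i (last h) = moves n i (last h')" using Prot[OF _ l] i h by (auto simp: last_map)
  moreover have "strat_of t i h = answer t (map (obs i) h')" using strat_of_num h by simp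
  ultimately show "strat_of t i h \<in> Prot G i (last h)"
    using i t h(2) by (auto simp: moves_def answer_def last_map)
next
  fix h h2 assume "h \<in> FPath G" "h2 \<in> FPath G" and ind: "indist G i h h2"
  then obtain h' h2' where h: "h = map num h'" "set h' \<subseteq> S" "h2 = map num h2'" "set h2' \<subseteq> S"
    using FPath_num by meson
  have "map (obs i) h' = map (obs i) h2'"
  proof (rule nth_equalityI)
    show "length (map (obs i) h') = length (map (obs i) h2')" using ind h by (simp add: indist_def)
    fix j assume j: "j < length (map (obs i) h')"
    then have j': "j < length h'" "j < length h2'" using ind h by (simp_all add: indist_def)
    then have "h' ! j \<in> S" "h2' ! j \<in> S" using h by auto
    moreover have "(num (h' ! j), num (h2' ! j)) \<in> Ind G i" using ind h j' by (auto simp: indist_def)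
    ultimately show "map (obs i) h' ! j = map (obs i) h2' ! j" using Ind[OF i] j' by simp
  qed
  then show "strat_of t i h = strat_of t i h2" using strat_of_num h by simp
qed

lemma count_list_snoc: "count_list (l @ [y]) c = count_list l c + of_bool (y = c)"
  by (simp add: count_list_append)

lemma tiles_imp_consistent:
  assumes t: "tiles {..<n} H V I x t" and r: "reach (strat_of t 1) (strat_of t 2) h"
  shows "consistent t (last h) (count_list (map (obs 1) h) W) (count_list (map (obs 1) h) W')
    (count_list (map (obs 2) h) W) (count_list (map (obs 2) h) W')"
proof -
  have tn: "t a b < n" for a b using t by (simp add: tiles_def)
  note s1 = iR_strat_of[OF tn, of 1, simplified] and s2 = iR_strat_of[OF tn, of 2, simplified]
  show ?thesis
    using r
  proof induction
    case reach_start
    show ?case by simp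
  next
    case (reach_step h e)
    have h: "h \<noteq> []" "set h \<subseteq> S" using reach_FPath[OF s1[folded One_nat_def] s2 reach_step(1)] by auto
    define q where "q = \<Delta> (last h) (strat_of t 1 (map num h)) (strat_of t 2 (map num h)) e"
    have "strat_of t i (map num h) = (if obs i (last h) = Ask
        then t (count_list (map (obs i) h) W - 1) (count_list (map (obs i) h) W' - 1) else 0)" for i
      using h by (simp add: strat_of_num answer_def last_map)
    from consistent_step[OF t reach_step.IH reach_step(2) this this q_def]
    show ?case unfolding q_def[symmetric] map_append list.map count_list_snoc last_snoc .
  qed
qed

theorem sat_iff_tiles:
  assumes \<pi>: "\<pi> 1 = iR" "\<pi> 2 = iR" "\<pi> 3 = IR"
  shows "sat_AG G \<pi> {1, 2} ok (num Top) \<longleftrightarrow> (\<exists>t. tiles {..<n} H V I x t)"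
  unfolding sat_iff[OF \<pi>]
proof
  assume "\<exists>t. tiles {..<n} H V I x t"
  then obtain t where t: "tiles {..<n} H V I x t" ..
  then have tn: "t a b < n" for a b by (simp add: tiles_def)
  show "\<exists>f g. iR_strat G 1 f \<and> iR_strat G 2 g \<and> (\<forall>h. reach f g h \<longrightarrow> last h \<noteq> Bad)"
  proof (intro exI conjI allI impI)
    show "iR_strat G 1 (strat_of t 1)" "iR_strat G 2 (strat_of t 2)" by (rule iR_strat_of[OF tn]; simp)+
    show "last h \<noteq> Bad" if "reach (strat_of t 1) (strat_of t 2) h" for h
      using tiles_imp_consistent[OF t that] by auto
  qed
next
  assume "\<exists>f g. iR_strat G 1 f \<and> iR_strat G 2 g \<and> (\<forall>h. reach f g h \<longrightarrow> last h \<noteq> Bad)"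
  then obtain f g where "iR_strat G 1 f" "iR_strat G 2 g" "\<And>h. reach f g h \<Longrightarrow> last h \<noteq> Bad" by auto
  then show "\<exists>t. tiles {..<n} H V I x t" by (intro exI) (rule winning_imp_tiles)
qed

end

section \<open>Finite descriptions of the games\<close>

text \<open>The states observed as \<open>W\<close> by player 1 are those numbered from \<open>num n Top\<close> on, and by player 2
  those from \<open>num n HFirst\<close> on.\<close>

fun num :: "nat \<Rightarrow> gstate \<Rightarrow> nat" where
  "num n Bad = 0"
| "num n Good = 1"
| "num n AskV = 2"
| "num n AskH = 3"
| "num n HWait = 4"
| "num n (Row k) = 5 + k"
| "num n (AskBoth k) = 9 + k"
| "num n (ReplyV t) = 13 + 2 * t"
| "num n (ReplyH t) = 14 + 2 * t"
| "num n HFirst = 13 + 2 * n"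
| "num n Top = 14 + 2 * n"
| "num n (Col j) = 15 + 2 * n + j"

lemma inj_num: "inj_on (num n) (states n x)"
proof (rule inj_onI)
  fix p q assume "p \<in> states n x" "q \<in> states n x" "num n p = num n q"
  then show "p = q"
    by (cases p; cases q; auto simp: states_def; presburger)
qed

lemma num_image: "num n ` states n x = {..<16 + 2 * n + x}"
proof (intro equalityI subsetI)
  fix u assume "u \<in> num n ` states n x"
  then show "u \<in> {..<16 + 2 * n + x}" by (auto simp: states_def)
next
  fix u assume u: "u \<in> {..<16 + 2 * n + x}"
  consider "u < 5" | "5 \<le> u" "u < 9" | "9 \<le> u" "u < 13" | "13 \<le> u" "u < 13 + 2 * n"
    | "u = 13 + 2 * n" | "u = 14 + 2 * n" | "15 + 2 * n \<le> u" by linarith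
  then have "\<exists>p. p \<in> states n x \<and> num n p = u"
  proof cases
    case 1
    then have "u \<in> {0, 1, 2, 3, 4}" by auto
    then show ?thesis
      using num.simps(1-5)[of n] unfolding states_def by (elim insertE) blast+
  next
    case 2
    then show ?thesis by (intro exI[of _ "Row (u - 5)"]) (auto simp: states_def)
  next
    case 3
    then show ?thesis by (intro exI[of _ "AskBoth (u - 9)"]) (auto simp: states_def)
  next
    case 4
    have "(\<exists>k. u = 13 + 2 * k \<and> k < n) \<or> (\<exists>k. u = 14 + 2 * k \<and> k < n)" using 4 by presburger
    then show ?thesis
    proof (elim disjE exE conjE)
      fix k assume "u = 13 + 2 * k" "k < n"
      then show ?thesis by (intro exI[of _ "ReplyV k"]) (simp add: states_def)
    next
      fix k assume "u = 14 + 2 * k" "k < n"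
      then show ?thesis by (intro exI[of _ "ReplyH k"]) (simp add: states_def)
    qed
  next
    case 5
    then show ?thesis by (intro exI[of _ HFirst]) (simp add: states_def)
  next
    case 6
    then show ?thesis by (intro exI[of _ Top]) (simp add: states_def)
  next
    case 7
    then show ?thesis using u by (intro exI[of _ "Col (u - 15 - 2 * n)"]) (auto simp: states_def)
  qed
  then show "u \<in> num n ` states n x" by blast
qed

lemma obs_W_iff:
  "p \<in> states n x \<Longrightarrow> obs 1 p = W \<longleftrightarrow> 14 + 2 * n \<le> num n p"
  "p \<in> states n x \<Longrightarrow> obs 2 p = W \<longleftrightarrow> 13 + 2 * n \<le> num n p"
  by (cases p; auto simp: states_def)+

text \<open>Splits off the states that the input adds; \<open>Col 0\<close> belongs to the fixed
  part.\<close>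

lemma states_chain: "states n x = states n 0 \<union> (\<lambda>j. Col (Suc j)) ` {..<x}"
proof -
  have "j \<in> {..x} \<longleftrightarrow> j \<in> insert 0 (Suc ` {..<x})" for j
    by (cases j) auto
  then have "{..x} = insert 0 (Suc ` {..<x})" by blast
  then have "Col ` {..x} = insert (Col 0) ((\<lambda>j. Col (Suc j)) ` {..<x})" by (simp add: image_image)
  then show ?thesis unfolding states_def by auto
qed

text \<open>The part of the description that does not depend on the input \<open>x\<close>.\<close>

definition base_states :: "nat \<Rightarrow> gstate list" where
  "base_states n = [Bad, Good, AskV, AskH, HWait, HFirst, Top] @ map Row [0..<4] @ map AskBoth [0..<4]
     @ map ReplyV [0..<n] @ map ReplyH [0..<n] @ [Col 0]"

lemma set_base_states: "set (base_states n) = states n 0"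
  by (auto simp: base_states_def states_def)

definition base_obs :: "nat \<Rightarrow> (nat \<times> nat \<times> nat) list" where
  "base_obs n = [(i, num n p, num n q). i \<leftarrow> [1, 2, 3], p \<leftarrow> base_states n, q \<leftarrow> base_states n,
     if i = 3 then p = q else obs i p = obs i q]"

definition moves_list :: "nat \<Rightarrow> nat \<Rightarrow> gstate \<Rightarrow> nat list" where
  "moves_list n i p = (if i = 3 then [0..<3] else if obs i p = Ask then [0..<n] else [0])"

lemma set_moves_list: "set (moves_list n i p) = moves n i p"
  by (simp add: moves_list_def moves_def atLeast0LessThan)

definition base_prot :: "nat \<Rightarrow> (nat \<times> nat \<times> nat) list" where
  "base_prot n = [(i, num n p, a). i \<leftarrow> [1, 2, 3], p \<leftarrow> base_states n, a \<leftarrow> moves_list n i p]"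

definition base_trans :: "nat \<Rightarrow> (nat \<Rightarrow> nat \<Rightarrow> bool) \<Rightarrow> (nat \<Rightarrow> nat \<Rightarrow> bool) \<Rightarrow> (nat \<Rightarrow> nat \<Rightarrow> bool)
    \<Rightarrow> (nat \<times> nat list \<times> nat) list" where
  "base_trans n H V I = [(num n p, [a, b, e], num n (\<delta> H V I 0 p a b e)).
     p \<leftarrow> base_states n, a \<leftarrow> [0..<n], b \<leftarrow> [0..<n], e \<leftarrow> [0..<3]]"

definition base_lab :: "nat \<Rightarrow> nat \<Rightarrow> (nat \<times> nat) list" where
  "base_lab n ok = [(num n p, ok). p \<leftarrow> base_states n, p \<noteq> Bad]"

text \<open>For \<open>k < square m\<close>, these pairs exhaust the square of the interval \<open>{c..c + m}\<close>, with repetitions.\<close>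

definition obs_pair :: "nat \<Rightarrow> nat \<Rightarrow> nat \<Rightarrow> nat \<Rightarrow> nat \<times> nat \<times> nat" where
  "obs_pair i c m k = (i, c + min (fst (prod_decode k)) m, c + min (snd (prod_decode k)) m)"

text \<open>One more than the largest code of a pair with both entries at most \<open>m\<close>. A
  single loop over codes of pairs thus replaces two nested ones, and the truncation in
  \<open>obs_pair\<close> makes the surplus codes harmless.\<close>

definition square :: "nat \<Rightarrow> nat" where
  "square m = Suc (prod_encode (m, m))"

text \<open>The order is reversed because \<open>loop\<close> puts its entries in front one after
  the other.\<close>

definition chain :: "nat \<Rightarrow> (nat \<Rightarrow> 'a) \<Rightarrow> 'a list \<Rightarrow> 'a list" where
  "chain x e l = map e (rev [0..<x]) @ l"

lemma set_chain: "set (chain x e l) = e ` {..<x} \<union> set l"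
  by (auto simp: chain_def)

lemma in_square:
  "(j, u, v) \<in> set (chain (square m) (obs_pair i c m) l) \<longleftrightarrow>
     j = i \<and> c \<le> u \<and> u \<le> c + m \<and> c \<le> v \<and> v \<le> c + m \<or> (j, u, v) \<in> set l"
proof -
  have "(i, c + a, c + b) \<in> obs_pair i c m ` {..<square m}" if "a \<le> m" "b \<le> m" for a b
  proof (rule image_eqI)
    show "(i, c + a, c + b) = obs_pair i c m (prod_encode (a, b))" using that by (simp add: obs_pair_def)
    have "triangle (a + b) \<le> triangle (m + m)"
      using that by (intro triangle_mono) simp
    then show "prod_encode (a, b) \<in> {..<square m}" using that by (simp add: square_def prod_encode_def)
  qed
  from this[of "u - c" "v - c"]
  have "j = i \<and> c \<le> u \<and> u \<le> c + m \<and> c \<le> v \<and> v \<le> c + m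
    \<Longrightarrow> (j, u, v) \<in> obs_pair i c m ` {..<square m}" by auto
  then show ?thesis unfolding set_chain by (auto simp: obs_pair_def)
qed

lemma num_image_chain:
  "u \<in> num n ` states n x \<longleftrightarrow> u \<in> num n ` states n 0 \<or> (\<exists>j<x. u = 16 + 2 * n + j)"
  unfolding states_chain[of n x] image_Un by (auto simp: image_iff)

text \<open>The first entry of \<open>d_trans\<close> overrides an entry of \<open>base_trans\<close>, since \<open>decode\<close> takes the first
  match. The numbers \<open>13 + 2 * n\<close>, \<open>14 + 2 * n\<close> and \<open>7\<close> are those of \<open>HFirst\<close>, \<open>Top\<close> and \<open>Row 2\<close>.\<close>

definition game_desc :: "nat \<Rightarrow> (nat \<Rightarrow> nat \<Rightarrow> bool) \<Rightarrow> (nat \<Rightarrow> nat \<Rightarrow> bool) \<Rightarrow> (nat \<Rightarrow> nat \<Rightarrow> bool)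
    \<Rightarrow> nat \<Rightarrow> nat \<Rightarrow> desc" where
  "game_desc n H V I ok x = (let N = 16 + 2 * n in \<lparr>
     d_n = N + x, d_init = [14 + 2 * n], d_m = 3, d_k = [n, n, 3],
     d_obs = chain (square (x + 1)) (obs_pair 1 (14 + 2 * n) (x + 1))
       (chain (square (x + 2)) (obs_pair 2 (13 + 2 * n) (x + 2))
       (chain x (\<lambda>j. (3, N + j, N + j)) (base_obs n))),
     d_prot = chain x (\<lambda>j. (1, N + j, 0)) (chain x (\<lambda>j. (2, N + j, 0)) (chain x (\<lambda>j. (3, N + j, 0))
       (chain x (\<lambda>j. (3, N + j, 1)) (chain x (\<lambda>j. (3, N + j, 2)) (base_prot n))))),
     d_trans = (14 + 2 * n, [0, 0, 0], 15 + 2 * n + x) #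
       chain x (\<lambda>j. (N + j, [0, 0, 0], 15 + 2 * n + j)) (chain x (\<lambda>j. (N + j, [0, 0, 1], 7))
       (chain x (\<lambda>j. (N + j, [0, 0, 2], 13 + 2 * n)) (base_trans n H V I))),
     d_lab = chain x (\<lambda>j. (N + j, ok)) (base_lab n ok),
     d_typ = [3, 3, 1]\<rparr>)"

lemma set_d_obs:
  "(i, u, v) \<in> set (d_obs (game_desc n H V I ok x)) \<longleftrightarrow>
     (i \<in> {1, 2} \<and> (\<exists>p\<in>states n x. \<exists>q\<in>states n x. u = num n p \<and> v = num n q \<and> obs i p = obs i q)) \<or>
     (i = 3 \<and> u = v \<and> u \<in> num n ` states n x)"
  (is "?L \<longleftrightarrow> ?R")
proof -
  let ?S = "states n x"
  have base: "(i, u, v) \<in> set (base_obs n) \<longleftrightarrow> (i \<in> {1, 2} \<and> (\<exists>p\<in>states n 0. \<exists>q\<in>states n 0.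
      u = num n p \<and> v = num n q \<and> obs i p = obs i q)) \<or> (i = 3 \<and> u = v \<and> u \<in> num n ` states n 0)"
    by (auto simp: base_obs_def set_base_states)
  have L: "?L \<longleftrightarrow> (i = 1 \<and> 14 + 2 * n \<le> u \<and> u \<le> 15 + 2 * n + x \<and> 14 + 2 * n \<le> v \<and> v \<le> 15 + 2 * n + x) \<or>
      (i = 2 \<and> 13 + 2 * n \<le> u \<and> u \<le> 15 + 2 * n + x \<and> 13 + 2 * n \<le> v \<and> v \<le> 15 + 2 * n + x) \<or>
      (i = 3 \<and> u = v \<and> (\<exists>j<x. u = 16 + 2 * n + j)) \<or> (i, u, v) \<in> set (base_obs n)"
    by (auto simp: game_desc_def Let_def in_square set_chain[of x])
  show ?thesis
  proof
    assume ?L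
    then consider "i = 1" "14 + 2 * n \<le> u" "u \<le> 15 + 2 * n + x" "14 + 2 * n \<le> v" "v \<le> 15 + 2 * n + x"
      | "i = 2" "13 + 2 * n \<le> u" "u \<le> 15 + 2 * n + x" "13 + 2 * n \<le> v" "v \<le> 15 + 2 * n + x"
      | "i = 3 \<and> u = v \<and> (\<exists>j<x. u = 16 + 2 * n + j) \<or> (i, u, v) \<in> set (base_obs n)"
      unfolding L by blast
    then show ?R
    proof cases
      case 1
      then have "u \<in> num n ` ?S" "v \<in> num n ` ?S" unfolding num_image by auto
      then obtain p q where pq: "p \<in> ?S" "u = num n p" "q \<in> ?S" "v = num n q" by blast
      have "obs 1 p = W" "obs 1 q = W" using 1 pq obs_W_iff(1) by auto
      then have "obs i p = obs i q" using 1(1) by simp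
      then show ?thesis using 1(1) pq by blast
    next
      case 2
      then have "u \<in> num n ` ?S" "v \<in> num n ` ?S" unfolding num_image by auto
      then obtain p q where pq: "p \<in> ?S" "u = num n p" "q \<in> ?S" "v = num n q" by blast
      have "obs 2 p = W" "obs 2 q = W" using 2 pq obs_W_iff(2) by auto
      then have "obs i p = obs i q" using 2(1) by simp
      then show ?thesis using 2(1) pq by blast
    next
      case 3
      then have "i = 3 \<and> u = v \<and> u \<in> num n ` ?S \<or> (i \<in> {1, 2} \<and>
          (\<exists>p\<in>states n 0. \<exists>q\<in>states n 0. u = num n p \<and> v = num n q \<and> obs i p = obs i q))"
        unfolding base num_image_chain[of u n x] by blast
      moreover have "states n 0 \<subseteq> ?S" unfolding states_chain[of n x] by blast
      ultimately show ?thesis by blast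
    qed
  next
    assume ?R
    then show ?L
    proof (elim disjE conjE bexE)
      fix p q assume i: "i \<in> {1, 2}" and pq: "p \<in> ?S" "q \<in> ?S" "u = num n p" "v = num n q" "obs i p = obs i q"
      show ?L
      proof (cases "p \<in> states n 0 \<and> q \<in> states n 0")
        case True
        then show ?thesis unfolding L base using i pq by blast
      next
        case False
        \<comment> \<open>A state outside the fixed part is some \<open>Col (Suc j)\<close>, seen as
          \<open>W\<close> by everyone, and the other state has the same observation.\<close>
        then have W: "obs i p = W" "obs i q = W" using pq unfolding states_chain[of n x] by auto
        have "u \<in> num n ` ?S" "v \<in> num n ` ?S" using pq by blast+
        then have "u \<le> 15 + 2 * n + x" "v \<le> 15 + 2 * n + x" unfolding num_image by auto
        then show ?thesis unfolding L using i W pq obs_W_iff by blast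
      qed
    next
      assume "i = 3" "u = v" "u \<in> num n ` ?S"
      then show ?L unfolding L base num_image_chain[of u n x] by blast
    qed
  qed
qed

lemma bex_states:
  "(\<exists>p\<in>states n x. Q p) \<longleftrightarrow> (\<exists>p\<in>states n 0. Q p) \<or> (\<exists>j<x. Q (Col (Suc j)))"
  unfolding states_chain[of n x] by blast

lemma set_d_prot:
  "(i, u, a) \<in> set (d_prot (game_desc n H V I ok x)) \<longleftrightarrow>
     i \<in> {1, 2, 3} \<and> (\<exists>p\<in>states n x. u = num n p \<and> a \<in> moves n i p)"
proof -
  have base: "(i, u, a) \<in> set (base_prot n) \<longleftrightarrow>
      i \<in> {1, 2, 3} \<and> (\<exists>p\<in>states n 0. u = num n p \<and> a \<in> moves n i p)"
    unfolding base_prot_def by (auto simp: set_base_states set_moves_list)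
  have L: "(i, u, a) \<in> set (d_prot (game_desc n H V I ok x)) \<longleftrightarrow>
      (\<exists>j<x. u = 16 + 2 * n + j) \<and> (i \<in> {1, 2} \<and> a = 0 \<or> i = 3 \<and> a \<in> {0, 1, 2}) \<or>
      (i, u, a) \<in> set (base_prot n)"
    by (simp add: game_desc_def Let_def set_chain image_iff) blast
  have "a \<in> moves n i (Col (Suc j)) \<longleftrightarrow> i \<noteq> 3 \<and> a = 0 \<or> i = 3 \<and> a \<in> {0, 1, 2}" for j
    by (auto simp: moves_def)
  then show ?thesis
    unfolding L base bex_states[of n x] by auto
qed

lemma set_d_lab:
  "(u, k) \<in> set (d_lab (game_desc n H V I ok x)) \<longleftrightarrow> k = ok \<and> (\<exists>p\<in>states n x. u = num n p \<and> p \<noteq> Bad)"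
proof -
  have "(u, k) \<in> set (base_lab n ok) \<longleftrightarrow> k = ok \<and> (\<exists>p\<in>states n 0. u = num n p \<and> p \<noteq> Bad)"
    by (auto simp: base_lab_def set_base_states)
  then show ?thesis
    unfolding bex_states[of n x] by (auto simp: game_desc_def Let_def set_chain)
qed

lemma find_unique:
  "\<lbrakk>y \<in> set l; P y; \<And>w. \<lbrakk>w \<in> set l; P w\<rbrakk> \<Longrightarrow> w = y\<rbrakk> \<Longrightarrow> find P l = Some y"
proof (induction l)
  case (Cons w l)
  show ?case
  proof (cases "P w")
    case True
    then have "w = y" by (rule Cons.prems(3)[OF list.set_intros(1)])
    then show ?thesis using True by simp
  next
    case False
    then have "y \<in> set l" using Cons.prems(1,2) by auto
    from Cons.IH[OF this Cons.prems(2) Cons.prems(3)[OF list.set_intros(2)]]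
    have "find P l = Some y" by simp
    then show ?thesis using False by simp
  qed
qed simp

definition trans_rest :: "nat \<Rightarrow> (nat \<Rightarrow> nat \<Rightarrow> bool) \<Rightarrow> (nat \<Rightarrow> nat \<Rightarrow> bool) \<Rightarrow> (nat \<Rightarrow> nat \<Rightarrow> bool) \<Rightarrow> nat
    \<Rightarrow> (nat \<times> nat list \<times> nat) list" where
  "trans_rest n H V I x = chain x (\<lambda>j. (16 + 2 * n + j, [0, 0, 0], 15 + 2 * n + j))
     (chain x (\<lambda>j. (16 + 2 * n + j, [0, 0, 1], 7))
     (chain x (\<lambda>j. (16 + 2 * n + j, [0, 0, 2], 13 + 2 * n)) (base_trans n H V I)))"

lemma d_trans_game_desc:
  "d_trans (game_desc n H V I ok x) = (14 + 2 * n, [0, 0, 0], 15 + 2 * n + x) # trans_rest n H V I x"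
  by (simp add: game_desc_def trans_rest_def Let_def)

lemma set_trans_rest:
  "w \<in> set (trans_rest n H V I x) \<longleftrightarrow>
     (\<exists>q\<in>states n 0. \<exists>a<n. \<exists>b<n. \<exists>e<3. w = (num n q, [a, b, e], num n (\<delta> H V I 0 q a b e))) \<or>
     (\<exists>j<x. \<exists>e<3. w = (num n (Col (Suc j)), [0, 0, e], num n (\<delta> H V I x (Col (Suc j)) 0 0 e)))"
proof -
  have base: "w \<in> set (base_trans n H V I) \<longleftrightarrow>
    (\<exists>q\<in>states n 0. \<exists>a<n. \<exists>b<n. \<exists>e<3. w = (num n q, [a, b, e], num n (\<delta> H V I 0 q a b e)))"
  proof -
    have bex: "(\<exists>a\<in>{0..<m}. Q a) \<longleftrightarrow> (\<exists>a<m. Q a)" for Q and m :: nat by auto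
    show ?thesis unfolding base_trans_def by (simp add: set_base_states image_iff bex)
  qed
  have ex3: "(\<exists>e<3. Q e) \<longleftrightarrow> Q 0 \<or> Q 1 \<or> Q (2::nat)" for Q
    by (auto simp: numeral_3_eq_3 numeral_2_eq_2 less_Suc_eq)
  show ?thesis
    unfolding trans_rest_def set_chain Un_iff base by (subst (2) ex3) (auto simp: image_iff)
qed

lemma \<delta>_closed: "\<lbrakk>p \<in> states n x; a < n\<rbrakk> \<Longrightarrow> \<delta> H V I x p a b e \<in> states n x"
  by (cases p) (auto simp: states_def)

lemma states_0_subset: "states n 0 \<subseteq> states n x"
  unfolding states_chain[of n x] by blast

lemma d_trans_bound:
  assumes "(u, as, v) \<in> set (d_trans (game_desc n H V I ok x))" and "0 < n"
  shows "v < 16 + 2 * n + x"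
proof -
  have bound: "num n p < 16 + 2 * n + x" if "p \<in> states n x" for p
    using that num_image[of n x] by blast
  from assms(1) consider "v = 15 + 2 * n + x"
    | q a b e where "q \<in> states n 0" "a < n" "v = num n (\<delta> H V I 0 q a b e)"
    | j e where "j < x" "v = num n (\<delta> H V I x (Col (Suc j)) 0 0 e)"
    unfolding d_trans_game_desc set_simps insert_iff set_trans_rest by blast
  then show ?thesis
  proof cases
    case 2
    then show ?thesis using bound \<delta>_closed[of q n 0 a] states_0_subset[of n x] by blast
  next
    case 3
    then have "Col (Suc j) \<in> states n x" by (simp add: states_def)
    from bound[OF \<delta>_closed[OF this assms(2)]] show ?thesis unfolding 3(2) .
  qed simp
qed

lemma find_d_trans:
  assumes p: "p \<in> states n x" and a: "a \<in> moves n 1 p" and b: "b \<in> moves n 2 p" and e: "e < 3" and n: "0 < n"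
  shows "find (\<lambda>(u, as, v). u = num n p \<and> as = [a, b, e]) (d_trans (game_desc n H V I ok x)) =
    Some (num n p, [a, b, e], num n (\<delta> H V I x p a b e))"
\<comment> \<open>This is the only legal situation in which \<open>base_trans\<close>, built with
  input 0, gives the wrong successor; the extra first entry corrects it.\<close>
proof (cases "p = Top \<and> e = 0")
  case True
  then show ?thesis using a b by (simp add: d_trans_game_desc moves_def)
next
  case False
  have Top: "Top \<in> states n x" by (simp add: states_def)
  have "num n p \<noteq> 14 + 2 * n \<or> e \<noteq> 0"
    using False inj_onD[OF inj_num _ p Top] by auto
  then have "find (\<lambda>(u, as, v). u = num n p \<and> as = [a, b, e]) (d_trans (game_desc n H V I ok x)) =
      find (\<lambda>(u, as, v). u = num n p \<and> as = [a, b, e]) (trans_rest n H V I x)"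
    by (auto simp: d_trans_game_desc)
  also have "\<dots> = Some (num n p, [a, b, e], num n (\<delta> H V I x p a b e))"
  proof (rule find_unique)
    \<comment> \<open>The input enters the transition function only at \<open>Top\<close> under move
      0, which is excluded here.\<close>
    have same: "\<delta> H V I 0 p a b e = \<delta> H V I x p a b e" using False by (cases p) auto
    have lt: "a < n" "b < n" using a b n by (auto simp: moves_def split: if_splits)
    from p consider "p \<in> states n 0" | j where "j < x" "p = Col (Suc j)"
      unfolding states_chain[of n x] by blast
    then show "(num n p, [a, b, e], num n (\<delta> H V I x p a b e)) \<in> set (trans_rest n H V I x)"
    proof cases
      case 1
      then show ?thesis unfolding set_trans_rest same[symmetric] using lt e by blast
    next
      case 2
      then have "a = 0" "b = 0" using a b by (simp_all add: moves_def)
      then show ?thesis unfolding set_trans_rest using 2 e by blast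
    qed
    fix w assume w: "w \<in> set (trans_rest n H V I x)" "case w of (u, as, v) \<Rightarrow> u = num n p \<and> as = [a, b, e]"
    from w(1) consider q a' b' e' where "q \<in> states n 0" "w = (num n q, [a', b', e'], num n (\<delta> H V I 0 q a' b' e'))"
      | j e' where "j < x" "w = (num n (Col (Suc j)), [0, 0, e'], num n (\<delta> H V I x (Col (Suc j)) 0 0 e'))"
      unfolding set_trans_rest by blast
    then show "w = (num n p, [a, b, e], num n (\<delta> H V I x p a b e))"
    proof cases
      case 1
      then have "q \<in> states n x" "num n q = num n p" using states_0_subset w(2) by auto
      then have "q = p" using inj_onD[OF inj_num] p by blast
      then show ?thesis using 1(2) w(2) same by simp
    next
      case 2
      then have "Col (Suc j) \<in> states n x" by (simp add: states_def)
      moreover have "num n (Col (Suc j)) = num n p" using 2(2) w(2) by (simp del: num.simps)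
      ultimately have "Col (Suc j) = p" using inj_onD[OF inj_num] p by blast
      then show ?thesis using 2(2) w(2) by (simp del: num.simps \<delta>.simps)
    qed
  qed simp
  finally show ?thesis .
qed

section \<open>Well-formedness of the described games\<close>

lemma decode_simps:
  "St (decode d) = {0..<d_n d}" "Init (decode d) = set (d_init d)" "Ag (decode d) = {1..d_m d}"
  "Ac (decode d) i = {0..<d_k d ! (i - 1)}" "Ind (decode d) i = {(p, q). (i, p, q) \<in> set (d_obs d)}"
  "Prot (decode d) i p = {a. (i, p, a) \<in> set (d_prot d)}"
  "Delta (decode d) p a = (case find (\<lambda>(u, as, t). u = p \<and> as = map a [1..<Suc (d_m d)]) (d_trans d) of
      Some (_, _, t) \<Rightarrow> t | None \<Rightarrow> 0)"
  "Lab (decode d) p = {k. (p, k) \<in> set (d_lab d)}"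
  by (simp_all add: decode_def)

lemma game_desc_simps:
  "d_n (game_desc n H V I ok x) = 16 + 2 * n + x" "d_init (game_desc n H V I ok x) = [14 + 2 * n]"
  "d_m (game_desc n H V I ok x) = 3" "d_k (game_desc n H V I ok x) = [n, n, 3]"
  "d_typ (game_desc n H V I ok x) = [3, 3, 1]"
  by (simp_all add: game_desc_def Let_def)

lemma decode_typ_game_desc:
  "decode_typ (game_desc n H V I ok x) 1 = iR" "decode_typ (game_desc n H V I ok x) 2 = iR"
  "decode_typ (game_desc n H V I ok x) 3 = IR"
  by (simp_all add: decode_typ_def game_desc_simps numeral_2_eq_2 numeral_3_eq_3)

lemma agents: "{1..3} = {1, 2, 3 :: nat}"
  by auto

lemma Ind_game_desc:
  "i \<in> {1, 2} \<Longrightarrow> Ind (decode (game_desc n H V I ok x)) i =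
     {(num n p, num n q) | p q. p \<in> states n x \<and> q \<in> states n x \<and> obs i p = obs i q}"
  "Ind (decode (game_desc n H V I ok x)) 3 = Id_on (num n ` states n x)"
  unfolding decode_simps set_d_obs by auto

lemma Prot_game_desc:
  "\<lbrakk>i \<in> {1, 2, 3}; p \<in> states n x\<rbrakk> \<Longrightarrow> Prot (decode (game_desc n H V I ok x)) i (num n p) = moves n i p"
  unfolding decode_simps set_d_prot using inj_onD[OF inj_num] by blast

lemma St_game_desc: "St (decode (game_desc n H V I ok x)) = num n ` states n x"
  by (simp add: decode_simps game_desc_simps num_image atLeast0LessThan)

lemma moves_cong: "obs i p = obs i q \<Longrightarrow> moves n i p = moves n i q"
  by (simp add: moves_def)

text \<open>Well-formedness also concerns profiles forbidden by the protocols, and some of these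
  match no entry. The default 0 of \<open>decode\<close> is the number of \<open>Bad\<close>, hence
  still a state.\<close>

lemma Delta_bound:
  assumes "0 < n"
  shows "Delta (decode (game_desc n H V I ok x)) p a < 16 + 2 * n + x"
proof (cases "find (\<lambda>(u, as, t). u = p \<and> as = map a [1..<Suc 3]) (d_trans (game_desc n H V I ok x))")
  case None
  then show ?thesis by (simp add: decode_simps game_desc_simps)
next
  case (Some w)
  obtain u as v where w: "w = (u, as, v)" by (cases w)
  have "w \<in> set (d_trans (game_desc n H V I ok x))"
    using Some by (metis find_Some_iff nth_mem)
  then have "v < 16 + 2 * n + x" using d_trans_bound assms unfolding w by blast
  moreover have "Delta (decode (game_desc n H V I ok x)) p a = v"
    unfolding decode_simps game_desc_simps(3) Some w by simp
  ultimately show ?thesis by simp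
qed

lemma equiv_Ind:
  assumes "i \<in> {1, 2, 3}"
  shows "equiv (num n ` states n x) (Ind (decode (game_desc n H V I ok x)) i)"
proof (cases "i = 3")
  case True
  then show ?thesis unfolding Ind_game_desc(2) True by (auto simp: equiv_def refl_on_def sym_def trans_def)
next
  case False
  then have i: "i \<in> {1, 2}" using assms by blast
  show ?thesis
    unfolding Ind_game_desc(1)[OF i]
  proof (rule equivI)
    show "trans {(num n p, num n q) |p q. p \<in> states n x \<and> q \<in> states n x \<and> obs i p = obs i q}"
    proof (rule transI)
      fix a b c
      assume "(a, b) \<in> {(num n p, num n q) |p q. p \<in> states n x \<and> q \<in> states n x \<and> obs i p = obs i q}"
        and "(b, c) \<in> {(num n p, num n q) |p q. p \<in> states n x \<and> q \<in> states n x \<and> obs i p = obs i q}"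
      then obtain p q q' r where "a = num n p" "b = num n q" "b = num n q'" "c = num n r"
        "{p, q, q', r} \<subseteq> states n x" "obs i p = obs i q" "obs i q' = obs i r" by blast
      moreover from this have "q = q'" using inj_onD[OF inj_num, of n q q' x] by simp
      ultimately show "(a, c) \<in> {(num n p, num n q) |p q. p \<in> states n x \<and> q \<in> states n x \<and> obs i p = obs i q}"
        by auto
    qed
    show "sym {(num n p, num n q) |p q. p \<in> states n x \<and> q \<in> states n x \<and> obs i p = obs i q}"
    proof (rule symI)
      fix a b
      assume "(a, b) \<in> {(num n p, num n q) |p q. p \<in> states n x \<and> q \<in> states n x \<and> obs i p = obs i q}"
      then obtain p q where "a = num n p" "b = num n q" "p \<in> states n x" "q \<in> states n x" "obs i p = obs i q"
        by blast
      then have "(b, a) = (num n q, num n p) \<and> q \<in> states n x \<and> p \<in> states n x \<and> obs i q = obs i p" by simp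
      then show "(b, a) \<in> {(num n p, num n q) |p q. p \<in> states n x \<and> q \<in> states n x \<and> obs i p = obs i q}"
        by (intro CollectI exI)
    qed
  qed (auto simp: refl_on_def)
qed

lemma valid_game_desc:
  assumes "0 < n" and "ok \<in> AP"
  shows "valid AP (game_desc n H V I ok x)"
proof -
  let ?d = "game_desc n H V I ok x"
  let ?G = "decode ?d"
  have Ag: "Ag ?G = {1, 2, 3}" unfolding decode_simps game_desc_simps(3) by (rule agents)
  have "cgs_wf AP ?G"
    unfolding cgs_wf_def
  proof (intro conjI ballI allI impI)
    show "finite (St ?G)" by (simp add: decode_simps)
    show "Init ?G \<subseteq> St ?G" by (simp add: decode_simps game_desc_simps)
    show "\<exists>m. Ag ?G = {1..m}" unfolding decode_simps by blast
    fix i assume i: "i \<in> Ag ?G"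
    show "finite (Ac ?G i)" by (simp add: decode_simps)
    show "equiv (St ?G) (Ind ?G i)" unfolding St_game_desc using i unfolding Ag by (rule equiv_Ind)
    show "Prot ?G i p \<subseteq> Ac ?G i" if pS: "p \<in> St ?G" for p
    proof -
      obtain q where q: "p = num n q" "q \<in> states n x" using pS unfolding St_game_desc by blast
      show ?thesis
        using i assms(1) unfolding q(1) Ag Prot_game_desc[OF i[unfolded Ag] q(2)] decode_simps(4) game_desc_simps
        by (auto simp: moves_def numeral_2_eq_2 numeral_3_eq_3 split: if_splits)
    qed
    fix p q assume pq: "(p, q) \<in> Ind ?G i"
    show "Prot ?G i p = Prot ?G i q"
    proof (cases "i = 3")
      case True
      then show ?thesis using pq unfolding True Ind_game_desc(2) by auto
    next
      case False
      then have i': "i \<in> {1, 2}" using i unfolding Ag by blast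
      then obtain p' q' where "p = num n p'" "q = num n q'" "p' \<in> states n x" "q' \<in> states n x" "obs i p' = obs i q'"
        using pq unfolding Ind_game_desc(1)[OF i'] by blast
      then show ?thesis using Prot_game_desc[OF i[unfolded Ag]] moves_cong by metis
    qed
  next
    fix p and a b :: "nat \<Rightarrow> nat" assume "\<forall>i\<in>Ag ?G. a i = b i"
    then have m: "map a [1..<Suc 3] = map b [1..<Suc 3]" unfolding Ag by (simp add: upt_rec numeral_2_eq_2 numeral_3_eq_3)
    show "Delta ?G p a = Delta ?G p b" unfolding decode_simps game_desc_simps(3) by (simp only: m)
  next
    show "Delta ?G p a \<in> St ?G" for p a
      using Delta_bound[OF assms(1)] by (simp add: decode_simps(1) game_desc_simps)
    show "Lab ?G p \<subseteq> AP" for p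
      using assms(2) unfolding decode_simps(8) set_d_lab by blast
  qed
  moreover have "Ind ?G i = Id_on (St ?G)" if "i \<in> Ag ?G" "decode_typ ?d i \<in> {IR, Ir}" for i
  proof -
    have "i = 3" using that decode_typ_game_desc(1,2)[of n H V I ok x] unfolding Ag by auto
    then show ?thesis unfolding St_game_desc using Ind_game_desc(2) by simp
  qed
  ultimately show ?thesis
    unfolding valid_def acgs_wf_def Ag using decode_typ_game_desc
    by (auto simp: game_desc_simps)
qed

lemma board_game_desc:
  assumes n: "0 < n"
  shows "board n H V I x ok (decode (game_desc n H V I ok x)) (num n)"
proof
  let ?G = "decode (game_desc n H V I ok x)"
  show "0 < n" by (rule n)
  show "inj_on (num n) (states n x)" by (rule inj_num)
  show "St ?G = num n ` states n x" by (rule St_game_desc)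
  show "Ag ?G = {1, 2, 3}" unfolding decode_simps game_desc_simps(3) by (rule agents)
  show "(num n p, num n q) \<in> Ind ?G i \<longleftrightarrow> obs i p = obs i q"
    if "i \<in> {1, 2}" "p \<in> states n x" "q \<in> states n x" for i p q
    unfolding Ind_game_desc(1)[OF that(1)] using that inj_onD[OF inj_num] by blast
  show "Prot ?G i (num n p) = moves n i p" if "i \<in> {1, 2, 3}" "p \<in> states n x" for i p
    using that by (rule Prot_game_desc)
  show "Delta ?G (num n p) a = num n (\<delta> H V I x p (a 1) (a 2) (a 3))"
    if p: "p \<in> states n x" and a: "\<And>i. i \<in> {1, 2, 3} \<Longrightarrow> a i \<in> moves n i p" for p a
  proof -
    have "a 3 < 3" using a[of 3] by (simp add: moves_def)
    moreover have "map a [1..<Suc 3] = [a 1, a 2, a 3]" by (simp add: upt_rec numeral_2_eq_2 numeral_3_eq_3)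
    ultimately show ?thesis
      unfolding decode_simps game_desc_simps(3)
      by (simp only: find_d_trans[OF p a a _ n] insertI1 insertI2 option.case prod.case)
  qed
  show "ok \<in> Lab ?G (num n p) \<longleftrightarrow> p \<noteq> Bad" if "p \<in> states n x" for p
    unfolding decode_simps(8) set_d_lab using that inj_onD[OF inj_num] by blast
qed

section \<open>Self-application\<close>

definition trans_code :: "nat \<times> nat list \<times> nat \<Rightarrow> nat" where
  "trans_code = (\<lambda>(u, as, t). prod_encode (u, prod_encode (list_encode as, t)))"

text \<open>The fixed lists are stored as codes, ready to be extended by \<open>loop\<close>. The
  constraints \<open>H\<close>, \<open>V\<close> and \<open>I\<close> enter only through the
  transitions.\<close>

definition template :: "nat \<Rightarrow> (nat \<Rightarrow> nat \<Rightarrow> bool) \<Rightarrow> (nat \<Rightarrow> nat \<Rightarrow> bool) \<Rightarrow> (nat \<Rightarrow> nat \<Rightarrow> bool) \<Rightarrow> nat \<Rightarrow> nat" where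
  "template n H V I ok = prod_encode (n, prod_encode (list_encode (map enc3 (base_obs n)),
     prod_encode (list_encode (map enc3 (base_prot n)),
     prod_encode (list_encode (map trans_code (base_trans n H V I)),
       list_encode (map prod_encode (base_lab n ok))))))"

definition tail :: "nat \<Rightarrow> nat \<Rightarrow> nat" where
  "tail i y = ((\<lambda>y. snd (prod_decode y)) ^^ i) y"

definition component :: "nat \<Rightarrow> nat \<Rightarrow> nat" where
  "component i y = fst (prod_decode (tail i y))"

lemma components_template:
  "component 0 (template n H V I ok) = n"
  "component 1 (template n H V I ok) = list_encode (map enc3 (base_obs n))"
  "component 2 (template n H V I ok) = list_encode (map enc3 (base_prot n))"
  "component 3 (template n H V I ok) = list_encode (map trans_code (base_trans n H V I))"
  "tail 4 (template n H V I ok) = list_encode (map prod_encode (base_lab n ok))"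
  by (simp_all add: component_def tail_def template_def numeral_2_eq_2 numeral_3_eq_3 numeral_eq_Suc)

text \<open>Here \<open>x\<close> plays two roles: its components are the fixed lists, and
  \<open>x\<close> itself is the number of chain states.\<close>

definition instance_code :: "nat \<Rightarrow> nat \<Rightarrow> nat" where
  "instance_code ok x = (let n = component 0 x; N = 16 + 2 * n in
     list_encode [N + x, list_encode [14 + 2 * n], 3, list_encode [n, n, 3],
       loop (\<lambda>k. enc3 (obs_pair 1 (14 + 2 * n) (x + 1) k))
         (loop (\<lambda>k. enc3 (obs_pair 2 (13 + 2 * n) (x + 2) k))
         (loop (\<lambda>j. enc3 (3, N + j, N + j)) (component 1 x) x) (square (x + 2))) (square (x + 1)),
       loop (\<lambda>j. enc3 (1, N + j, 0)) (loop (\<lambda>j. enc3 (2, N + j, 0)) (loop (\<lambda>j. enc3 (3, N + j, 0))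
         (loop (\<lambda>j. enc3 (3, N + j, 1)) (loop (\<lambda>j. enc3 (3, N + j, 2)) (component 2 x) x) x) x) x) x,
       Suc (prod_encode (trans_code (14 + 2 * n, [0, 0, 0], 15 + 2 * n + x),
         loop (\<lambda>j. trans_code (N + j, [0, 0, 0], 15 + 2 * n + j))
         (loop (\<lambda>j. trans_code (N + j, [0, 0, 1], 7))
         (loop (\<lambda>j. trans_code (N + j, [0, 0, 2], 13 + 2 * n)) (component 3 x) x) x) x)),
       loop (\<lambda>j. prod_encode (N + j, ok)) (tail 4 x) x,
       list_encode [3, 3, 1]])"

lemma list_encode_chain:
  "list_encode (map f (chain x e l)) = loop (\<lambda>j. f (e j)) (list_encode (map f l)) x"
  by (simp add: loop_list_encode chain_def o_def)

text \<open>The two roles of \<open>x\<close> fit together only if \<open>x\<close> is the template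
  of this very game; the diagonal argument uses no other case.\<close>

lemma code_game_desc:
  assumes "x = template n H V I ok"
  shows "code (game_desc n H V I ok x) = instance_code ok x"
  using components_template[of n H V I ok, folded assms]
  unfolding code_def instance_code_def game_desc_def Let_def
  by (simp add: list_encode_chain flip: trans_code_def)

lemma recursive_double: "recursive k A \<Longrightarrow> recursive k (\<lambda>xs. 2 * A xs)"
  unfolding mult_2 by (intro recursive_add)

lemma recursive_tail: "recursive k A \<Longrightarrow> recursive k (\<lambda>xs. tail i (A xs))"
  unfolding tail_def by (induction i) (simp_all add: recursive_snd_prod_decode)

lemma recursive_component: "recursive k A \<Longrightarrow> recursive k (\<lambda>xs. component i (A xs))"
  unfolding component_def by (intro recursive_fst_prod_decode recursive_tail)

lemma recursive_instance_code: "recursive 1 (\<lambda>xs. instance_code ok (xs ! 0))"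
  unfolding instance_code_def Let_def list_encode.simps enc3_def obs_pair_def trans_code_def prod.case square_def
  by (intro recursive_loop recursive_Suc recursive_prod_encode recursive_add recursive_double recursive_min
      recursive_fst_prod_decode recursive_snd_prod_decode recursive_component recursive_tail
      recursive_arg recursive_const) simp_all

theorem theorem1:
  fixes AP :: "nat set" and ok :: nat
  assumes "finite AP" and "ok \<in> AP"
  shows "\<not> (\<exists>f. \<forall>d. valid AP d \<longrightarrow>
            reval f [code d]
              (if (\<forall>s0\<in>Init (decode d). sat_AG (decode d) (decode_typ d) {1, 2} ok s0)
               then 1 else 0))"
proof
  assume "\<exists>f. \<forall>d. valid AP d \<longrightarrow> reval f [code d]
    (if (\<forall>s0\<in>Init (decode d). sat_AG (decode d) (decode_typ d) {1, 2} ok s0) then 1 else 0)"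
  then obtain f where f: "\<And>d. valid AP d \<Longrightarrow> reval f [code d]
    (if (\<forall>s0\<in>Init (decode d). sat_AG (decode d) (decode_typ d) {1, 2} ok s0) then 1 else 0)"
    by blast
  obtain g where "\<forall>xs. length xs = 1 \<longrightarrow> reval g xs (instance_code ok (xs ! 0))"
    using recursive_instance_code[of ok] unfolding recursive_def by blast
  then have g: "reval g [x] (instance_code ok x)" for x
    by (auto dest: spec[of _ "[x]"])
  have h: "reval (Cn 1 f [g]) [x] r" if "reval f [instance_code ok x] r" for x r
    by (rule reval_Cn[OF _ _ _ that]) (simp_all add: g)
  obtain c where c: "\<And>x r. \<lbrakk>reval (Cn 1 f [g]) [x] r; r \<le> 1\<rbrakk> \<Longrightarrow> halts c (Suc x) \<longleftrightarrow> r = 1"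
    by (rule halting_machine[of "Cn 1 f [g]"]) (rule that)
  obtain n :: nat and H V I where n: "0 < n"
    and tiling: "\<And>x. (\<exists>t. tiles {..<n} H V I x t) \<longleftrightarrow> \<not> halts c (Suc x)"
    by (rule halting_to_tiling[of c]) (rule that)
  \<comment> \<open>There is no circularity: \<open>n\<close>, \<open>H\<close>, \<open>V\<close>
    and \<open>I\<close> come from \<open>c\<close> alone and \<open>tiling\<close> holds for every
    input, so the input may be chosen afterwards as the number describing them.\<close>
  define x where "x = template n H V I ok"
  let ?d = "game_desc n H V I ok x"
  interpret board n H V I x ok "decode ?d" "num n"
    by (rule board_game_desc[OF n])
  have "Init (decode ?d) = {num n Top}"
    by (simp add: decode_simps game_desc_simps)
  then have sat: "(\<forall>s0\<in>Init (decode ?d). sat_AG (decode ?d) (decode_typ ?d) {1, 2} ok s0) \<longleftrightarrow> \<not> halts c (Suc x)"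
    using sat_iff_tiles[OF decode_typ_game_desc] tiling by simp
  have "reval f [instance_code ok x] (if \<not> halts c (Suc x) then 1 else 0)"
    using f[OF valid_game_desc[OF n assms(2)], of H V I x] unfolding sat code_game_desc[OF x_def] .
  \<comment> \<open>The computed value is 1 iff \<open>c\<close> does not halt on
    \<open>Suc x\<close>, whereas by construction \<open>c\<close> halts there iff this value is
    1.\<close>
  from c[OF h[OF this]] show False
    by (cases "halts c (Suc x)") simp_all
qed

end
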